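(* Let $s\geq 2$ and $N\geq 3$ be integers, and let $A\subset [N]$ with $|A|=\delta N$. Suppose that \[ \delta\geq 100\left(\frac{\log\log N}{\log N}\right)^{\frac{1}{6s(s+1)}}. \] Then $A$ contains a nontrivial $s$-configuration.
   Context: $[N]=\{1,2,\dots,N\}$. For an integer $s\geq 2$, an $s$-configuration is a set of integers of the form $\{n_i+n_j+a : 1\leq i\leq j\leq s\}$ with $n_1,\dots,n_s,a\in\mathbb{Z}$ (the $s(s+1)/2$ listed integers are allowed to coincide). It is called nontrivial if $n_1,\dots,n_s$ are all distinct. "$A$ contains a nontrivial $s$-configuration" means that there are distinct integers $n_1,\dots,n_s$ and an integer $a$ with $n_i+n_j+a\in A$ for all $1\leq i\leq j\leq s$. *)

theory Defs
  imports Complex_Main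
begin

text \<open>The tuple $n_1,\dots,n_s$ is a function on the naturals of which only the values on
  \<open>{1..s}\<close> matter.\<close>

definition configuration :: "nat \<Rightarrow> (nat \<Rightarrow> int) \<Rightarrow> int \<Rightarrow> int set" where
  "configuration s n a = {n i + n j + a | i j. 1 \<le> i \<and> i \<le> j \<and> j \<le> s}"

definition contains_nontrivial_configuration :: "nat \<Rightarrow> int set \<Rightarrow> bool" where
  "contains_nontrivial_configuration s A \<longleftrightarrow>
     (\<exists>n a. inj_on n {1..s} \<and> configuration s n a \<subseteq> A)"

end

theory Submission
  imports Defs "HOL-Library.FuncSet"
begin

text \<open>The argument is a density increment on Bohr sets of integers. Suppose \<open>A\<close> has density \<open>\<alpha>\<close> on a
  translate of a regular Bohr set \<open>B0\<close>, and let \<open>B1\<close>, \<open>B2\<close>, \<open>B3\<close> be much smaller Bohr sets. For a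
  suitable \<open>Y\<close> the vertex set \<open>{n \<in> B1. 2n + Y \<in> A}\<close> is dense in \<open>B1\<close>, and an \<open>s\<close>-clique of the graph
  \<open>n + m + Y \<in> A\<close> on it is a nontrivial configuration. Greedy selection produces a clique unless some
  dense \<open>V \<subseteq> B1\<close> spans at most half of the expected number of edges. Restricting one of the two
  variables to a translate of \<open>B2\<close> and expanding the indicator function of \<open>V\<close> there into few
  characters plus a Fourier-uniform remainder shows that \<open>A - \<alpha>\<close> correlates with one character \<open>\<theta>\<close> on
  translates of \<open>B2\<close>, hence \<open>A\<close> has larger density on a translate of a Bohr set \<open>B3\<close> with the extra
  frequency \<open>\<theta>\<close>. With \<open>\<eta>\<close> of order \<open>\<alpha>^(2s-1)\<close> each step gains at least about \<open>\<alpha> \<eta>^4\<close> and costs one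
  frequency and a factor polynomial in \<open>log N\<close> in the radius, so that after \<open>T\<close> steps, \<open>T\<close> about
  \<open>1 / (\<alpha> \<eta>^4)\<close>, the Bohr set still has about \<open>N / (log N)^O(T^2)\<close> elements.\<close>

section \<open>Characters and bilinear forms\<close>

definition chr :: "real \<Rightarrow> int \<Rightarrow> complex" where
  "chr \<theta> k = cis (2 * pi * \<theta> * of_int k)"

lemma norm_chr [simp]: "norm (chr \<theta> k) = 1"
  by (simp add: chr_def)

lemma chr_add: "chr \<theta> (k + l) = chr \<theta> k * chr \<theta> l"
  by (simp add: chr_def cis_mult algebra_simps)

lemma chr_mult_cnj [simp]: "chr \<theta> k * cnj (chr \<theta> k) = 1"
  by (simp add: chr_def cis_cnj cis_mult)

lemma norm_cis_minus_one_le: "norm (cis x - 1) \<le> \<bar>x\<bar>"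
proof -
  have "(norm (cis x - 1))\<^sup>2 = (cos x - 1)\<^sup>2 + (sin x)\<^sup>2"
    by (simp add: cmod_power2)
  also have "\<dots> = 2 - 2 * cos x"
    using sin_cos_squared_add[of x] by (simp add: power2_eq_square algebra_simps)
  also have "\<dots> = \<bar>2 * sin (x/2)\<bar>\<^sup>2"
    using cos_double_sin[of "x/2"] by (simp add: power2_eq_square)
  finally have "norm (cis x - 1) = \<bar>2 * sin (x/2)\<bar>"
    by (rule power2_eq_imp_eq) auto
  also have "\<dots> \<le> \<bar>x\<bar>"
    using abs_sin_x_le_abs_x[of "x/2"] by simp
  finally show ?thesis .
qed

lemma norm_chr_minus_one_le:
  assumes "\<bar>\<theta> * of_int k - of_int m\<bar> \<le> \<rho>"
  shows "norm (chr \<theta> k - 1) \<le> 2 * pi * \<rho>"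
proof -
  have "cis (2 * pi * \<theta> * of_int k) = cis (2 * pi * of_int m + 2 * pi * (\<theta> * of_int k - of_int m))"
    by (simp add: algebra_simps)
  also have "\<dots> = cis (2 * pi * (\<theta> * of_int k - of_int m))"
    by (subst cis_mult [symmetric]) (simp add: cis_multiple_2pi)
  finally have "norm (chr \<theta> k - 1) \<le> \<bar>2 * pi * (\<theta> * of_int k - of_int m)\<bar>"
    unfolding chr_def by (simp only: norm_cis_minus_one_le)
  also have "\<dots> \<le> 2 * pi * \<rho>"
    using assms by (simp add: abs_mult)
  finally show ?thesis .
qed

section \<open>Fourier analysis of finitely supported functions on the integers\<close>

text \<open>A geometric sum of \<open>M\<close>-th roots of unity. The bound on
  \<open>\<bar>z\<bar>\<close> leaves 0 as the only multiple of \<open>M\<close>, so the frequencies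
  \<open>r / M\<close> detect equality of integers and not merely congruence.\<close>

lemma sum_chr_orthogonal:
  fixes z :: int and M :: nat
  assumes "\<bar>z\<bar> < int M"
  shows "(\<Sum>r<M. chr (real r / real M) z) = (if z = 0 then of_nat M else 0)"
proof (cases "z = 0")
  case True
  then show ?thesis by (simp add: chr_def)
next
  case False
  have M: "M > 0" using assms by linarith
  define w where "w = cis (2 * pi * of_int z / of_nat M)"
  have pw: "chr (real r / real M) z = w ^ r" for r
    unfolding chr_def w_def Complex.DeMoivre by (simp add: algebra_simps)
  have wM: "w ^ M = 1"
    unfolding w_def Complex.DeMoivre using M by (simp add: cis_multiple_2pi)
  have "w \<noteq> 1"
  proof
    assume "w = 1"
    then have "cos (2 * pi * of_int z / of_nat M) = 1"
      unfolding w_def by (simp add: complex_eq_iff)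
    then obtain n :: int where "2 * pi * of_int z / of_nat M = of_int n * 2 * pi"
      using cos_one_2pi_int by blast
    then have "real_of_int z = of_int n * of_nat M"
      using M pi_gt_zero by (simp add: field_simps)
    then have "z = n * int M"
      by (metis of_int_eq_iff of_int_mult of_int_of_nat_eq)
    with False assms show False
      by (metis abs_mult abs_of_nat dual_order.strict_trans1 mult_eq_0_iff mult_le_cancel_right1
          not_less zabs_less_one_iff zero_less_one_class.zero_le_one of_nat_0_le_iff linorder_not_le)
  qed
  then have "(\<Sum>r<M. w ^ r) = 0"
    using wM by (simp add: sum_gp_strict)
  then show ?thesis using False by (simp add: pw)
qed

text \<open>Since \<open>M\<close> exceeds every difference in \<open>S\<close>, the set embeds in
  the residues mod \<open>M\<close>, and the discrete Parseval identity has no wrap-around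
  terms.\<close>

lemma parseval_bounded_support:
  fixes g :: "int \<Rightarrow> complex" and S :: "int set" and M :: nat
  assumes "finite S" and "\<And>x y. x \<in> S \<Longrightarrow> y \<in> S \<Longrightarrow> \<bar>x - y\<bar> < int M"
  shows "(\<Sum>r<M. (norm (\<Sum>x\<in>S. g x * chr (real r / real M) x))\<^sup>2) = M * (\<Sum>x\<in>S. (norm (g x))\<^sup>2)"
proof -
  let ?e = "\<lambda>r. chr (real r / real M)"
  have "complex_of_real (\<Sum>r<M. (norm (\<Sum>x\<in>S. g x * ?e r x))\<^sup>2)
      = (\<Sum>r<M. (\<Sum>x\<in>S. g x * ?e r x) * cnj (\<Sum>x\<in>S. g x * ?e r x))"
    by (simp only: of_real_sum complex_norm_square)
  also have "\<dots> = (\<Sum>r<M. \<Sum>x\<in>S. \<Sum>y\<in>S. g x * cnj (g y) * ?e r (x - y))"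
  proof (intro sum.cong refl)
    fix r
    have "cnj (?e r y) = ?e r (- y)" for y
      by (simp add: chr_def cis_cnj)
    then have "g x * ?e r x * cnj (g y * ?e r y) = g x * cnj (g y) * ?e r (x - y)" for x y
      using chr_add[of "real r / real M" x "- y"] by simp
    then show "(\<Sum>x\<in>S. g x * ?e r x) * cnj (\<Sum>x\<in>S. g x * ?e r x)
        = (\<Sum>x\<in>S. \<Sum>y\<in>S. g x * cnj (g y) * ?e r (x - y))"
      by (simp only: sum_product cnj_sum)
  qed
  also have "\<dots> = (\<Sum>x\<in>S. \<Sum>y\<in>S. g x * cnj (g y) * (\<Sum>r<M. ?e r (x - y)))"
    by (subst sum.swap, intro sum.cong refl, subst sum.swap) (simp add: sum_distrib_left)
  also have "\<dots> = (\<Sum>x\<in>S. \<Sum>y\<in>S. if y = x then g x * cnj (g y) * of_nat M else 0)"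
    by (intro sum.cong refl) (use assms(2) in \<open>simp add: sum_chr_orthogonal\<close>)
  also have "\<dots> = (\<Sum>x\<in>S. g x * cnj (g x) * of_nat M)"
    using assms(1) by simp
  also have "\<dots> = complex_of_real (M * (\<Sum>x\<in>S. (norm (g x))\<^sup>2))"
    by (simp only: of_real_mult of_real_sum complex_norm_square sum_distrib_left of_real_of_nat_eq mult.commute)
  finally show ?thesis
    using of_real_eq_iff by blast
qed

text \<open>In Fourier space the form is an average of \<open>uh * vh * cnj Fh\<close>. The supremum
  of \<open>vh\<close> is taken out; the other two factors are handled in mean square by AM-GM and
  Parseval, which produces \<open>card U\<close> and \<open>card S\<close>.\<close>

lemma bilinear_fourier_bound:
  fixes u v F :: "int \<Rightarrow> complex"
  assumes fin: "finite U" "finite V" "finite S"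
    and sub: "\<And>n k. n \<in> U \<Longrightarrow> k \<in> V \<Longrightarrow> n + k \<in> S"
    and unif: "\<And>\<theta>. norm (\<Sum>k\<in>V. v k * chr \<theta> k) \<le> D"
    and u1: "\<And>n. norm (u n) \<le> 1" and F1: "\<And>n. norm (F n) \<le> 1"
  shows "norm (\<Sum>n\<in>U. \<Sum>k\<in>V. u n * v k * F (n + k)) \<le> D * (real (card U) + real (card S)) / 2"
proof -
  define R where "R = Max (insert 0 (abs ` (U \<union> V \<union> S)))"
  have R: "\<bar>x\<bar> \<le> R" if "x \<in> U \<union> V \<union> S" for x
    unfolding R_def using that fin by (intro Max_ge) auto
  have R0: "R \<ge> 0" unfolding R_def using fin by (intro Max_ge) auto
  \<comment> \<open>Every \<open>n + k - x\<close> is at most \<open>3 * R\<close> in absolute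
    value, so vanishing mod \<open>M\<close> means vanishing.\<close>
  define M where "M = nat (3 * R + 1)"
  have M: "int M = 3 * R + 1" "M > 0" using R0 by (auto simp: M_def)
  let ?e = "\<lambda>r::nat. chr (real r / real M)"
  have D0: "D \<ge> 0" using unif[of 0] norm_ge_zero order_trans by blast
  define Fh where "Fh r = (\<Sum>x\<in>S. cnj (F x) * ?e r x)" for r
  define uh where "uh r = (\<Sum>x\<in>U. u x * ?e r x)" for r
  define vh where "vh r = (\<Sum>x\<in>V. v x * ?e r x)" for r
  have cnj_e: "cnj (?e r y) = ?e r (- y)" for r y
    by (simp add: chr_def cis_cnj)
  have "(\<Sum>r<M. uh r * vh r * cnj (Fh r))
      = (\<Sum>r<M. \<Sum>n\<in>U. \<Sum>k\<in>V. \<Sum>x\<in>S. u n * v k * F x * ?e r (n + k - x))"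
  proof (intro sum.cong refl)
    fix r
    have *: "u n * v k * F x * ?e r (n + k - x) = u n * ?e r n * (v k * ?e r k) * (F x * ?e r (- x))"
      for n k x
      using chr_add[of "real r / real M" "n + k" "- x"] chr_add[of "real r / real M" n k] by simp
    show "uh r * vh r * cnj (Fh r)
        = (\<Sum>n\<in>U. \<Sum>k\<in>V. \<Sum>x\<in>S. u n * v k * F x * ?e r (n + k - x))"
      unfolding * uh_def vh_def Fh_def cnj_sum complex_cnj_mult cnj_e complex_cnj_cnj
      by (simp only: sum_distrib_left [symmetric] sum_distrib_right [symmetric])
  qed
  also have "\<dots> = (\<Sum>n\<in>U. \<Sum>k\<in>V. \<Sum>x\<in>S. \<Sum>r<M. u n * v k * F x * ?e r (n + k - x))"
    by (simp only: sum.swap[where A = "{..<M}"])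
  also have "\<dots> = (\<Sum>n\<in>U. \<Sum>k\<in>V. \<Sum>x\<in>S. if n + k = x then of_nat M * (u n * v k * F x) else 0)"
  proof (intro sum.cong refl)
    fix n k x assume *: "n \<in> U" "k \<in> V" "x \<in> S"
    have "\<bar>n + k - x\<bar> < int M" using R[of n] R[of k] R[of x] * M by auto
    then show "(\<Sum>r<M. u n * v k * F x * ?e r (n + k - x))
        = (if n + k = x then of_nat M * (u n * v k * F x) else 0)"
      by (simp add: sum_distrib_left [symmetric] sum_chr_orthogonal)
  qed
  also have "\<dots> = (\<Sum>n\<in>U. \<Sum>k\<in>V. of_nat M * (u n * v k * F (n + k)))"
    using fin sub by (intro sum.cong refl) simp
  also have "\<dots> = of_nat M * (\<Sum>n\<in>U. \<Sum>k\<in>V. u n * v k * F (n + k))"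
    by (simp add: sum_distrib_left)
  finally have "real M * norm (\<Sum>n\<in>U. \<Sum>k\<in>V. u n * v k * F (n + k))
      = norm (\<Sum>r<M. uh r * vh r * cnj (Fh r))"
    by (simp only: norm_mult norm_of_nat)
  also have "\<dots> \<le> (\<Sum>r<M. D * ((norm (uh r))\<^sup>2 + (norm (Fh r))\<^sup>2) / 2)"
  proof (intro sum_norm_le)
    fix r
    have "norm (uh r * vh r * cnj (Fh r)) = norm (vh r) * (norm (uh r) * norm (Fh r))"
      by (simp add: norm_mult)
    also have "\<dots> \<le> D * (((norm (uh r))\<^sup>2 + (norm (Fh r))\<^sup>2) / 2)"
    proof (intro mult_mono)
      show "norm (vh r) \<le> D" unfolding vh_def by (rule unif)
      show "norm (uh r) * norm (Fh r) \<le> ((norm (uh r))\<^sup>2 + (norm (Fh r))\<^sup>2) / 2"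
        using sum_squares_bound[of "norm (uh r)" "norm (Fh r)"] by simp
    qed (use D0 in auto)
    finally show "norm (uh r * vh r * cnj (Fh r)) \<le> D * ((norm (uh r))\<^sup>2 + (norm (Fh r))\<^sup>2) / 2"
      by simp
  qed
  also have "\<dots> = D * ((\<Sum>r<M. (norm (uh r))\<^sup>2) + (\<Sum>r<M. (norm (Fh r))\<^sup>2)) / 2"
    by (simp add: sum_divide_distrib [symmetric] sum_distrib_left sum.distrib [symmetric])
  also have "(\<Sum>r<M. (norm (uh r))\<^sup>2) = M * (\<Sum>x\<in>U. (norm (u x))\<^sup>2)"
    unfolding uh_def
  proof (rule parseval_bounded_support[OF fin(1)])
    fix x y assume "x \<in> U" "y \<in> U"
    then show "\<bar>x - y\<bar> < int M" using R[of x] R[of y] M(1) R0 by auto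
  qed
  also have "(\<Sum>r<M. (norm (Fh r))\<^sup>2) = M * (\<Sum>x\<in>S. (norm (cnj (F x)))\<^sup>2)"
    unfolding Fh_def
  proof (rule parseval_bounded_support[OF fin(3)])
    fix x y assume "x \<in> S" "y \<in> S"
    then show "\<bar>x - y\<bar> < int M" using R[of x] R[of y] M(1) R0 by auto
  qed
  also have "D * (M * (\<Sum>x\<in>U. (norm (u x))\<^sup>2) + M * (\<Sum>x\<in>S. (norm (cnj (F x)))\<^sup>2)) / 2
      \<le> D * (real M * real (card U) + real M * real (card S)) / 2"
  proof -
    have "(\<Sum>x\<in>U. (norm (u x))\<^sup>2) \<le> card U"
      using sum_bounded_above[of U "\<lambda>x. (norm (u x))\<^sup>2" 1] u1 by (simp add: power_le_one)
    moreover have "(\<Sum>x\<in>S. (norm (cnj (F x)))\<^sup>2) \<le> card S"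
      using sum_bounded_above[of S "\<lambda>x. (norm (cnj (F x)))\<^sup>2" 1] F1 by (simp add: power_le_one)
    ultimately show ?thesis using D0
      by (intro divide_right_mono mult_left_mono add_mono) (auto intro!: mult_left_mono)
  qed
  also have "\<dots> = real M * (D * (card U + card S) / 2)"
    by (simp add: algebra_simps)
  finally show ?thesis using M(2) by (simp add: mult_le_cancel_left_pos)
qed

text \<open>Energy decrement: subtract the projection onto a character until \<open>v\<close> is uniform. The form
  \<open>\<Phi>\<close> is then controlled by its values on characters, with no loss from doubling of \<open>V\<close>.\<close>

lemma form_bound_by_characters:
  fixes \<Phi> :: "(int \<Rightarrow> complex) \<Rightarrow> complex" and \<kappa> D C :: real
  assumes fin: "finite V" "V \<noteq> {}" and \<kappa>: "\<kappa> > 0" and D: "D \<ge> 0"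
    and lin: "\<And>v w c. \<Phi> (\<lambda>k. v k - c * w k) = \<Phi> v - c * \<Phi> w"
    and char: "\<And>\<theta>. norm (\<Phi> (chr \<theta>)) \<le> D"
    and unif: "\<And>v. (\<And>\<theta>. norm (\<Sum>k\<in>V. v k * chr \<theta> k) \<le> \<kappa> * card V) \<Longrightarrow> norm (\<Phi> v) \<le> C"
    and energy: "(\<Sum>k\<in>V. (norm (v k))\<^sup>2) \<le> real j * \<kappa>\<^sup>2 * card V" "(\<Sum>k\<in>V. (norm (v k))\<^sup>2) \<le> card V"
  shows "norm (\<Phi> v) \<le> C + real j * D"
  using energy
proof (induction j arbitrary: v)
  case 0
  then have "(\<Sum>k\<in>V. (norm (v k))\<^sup>2) = 0"
    by (intro antisym sum_nonneg) auto
  then have "\<forall>k\<in>V. v k = 0"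
    using fin(1) by (simp add: sum_nonneg_eq_0_iff)
  then show ?case using unif[of v] \<kappa> by simp
next
  case (Suc j)
  show ?case
  proof (cases "\<forall>\<theta>. norm (\<Sum>k\<in>V. v k * chr \<theta> k) \<le> \<kappa> * card V")
    case True
    then show ?thesis using unif[of v] D by (simp add: add_increasing2)
  next
    case False
    then obtain \<theta> where \<theta>: "norm (\<Sum>k\<in>V. v k * chr \<theta> k) > \<kappa> * card V" by (auto simp: not_le)
    have cV: "card V > 0" using fin by (simp add: card_gt_0_iff)
    define c where "c = (\<Sum>k\<in>V. v k * chr \<theta> k) / card V"
    have c: "(\<Sum>k\<in>V. v k * chr \<theta> k) = card V * c" using cV by (simp add: c_def)
    have nc: "norm c > \<kappa>" using \<theta> cV unfolding c by (simp add: norm_mult field_simps)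
    \<comment> \<open>Pairing with \<open>chr \<theta>\<close> is the inner product with
      \<open>chr (- \<theta>)\<close>, so \<open>c\<close> is the coefficient of \<open>v\<close>
      along \<open>chr (- \<theta>)\<close> and \<open>w\<close> is the part orthogonal to it. The
      energy drops by \<open>card V * (norm c)\<^sup>2\<close>.\<close>
    define w where "w k = v k - c * chr (- \<theta>) k" for k
    have cn: "cnj (chr (- \<theta>) k) = chr \<theta> k" for k by (simp add: chr_def cis_cnj)
    have "complex_of_real (\<Sum>k\<in>V. (norm (w k))\<^sup>2) = (\<Sum>k\<in>V. w k * cnj (w k))"
      by (simp only: of_real_sum complex_norm_square)
    also have "\<dots> = (\<Sum>k\<in>V. v k * cnj (v k) - cnj c * (v k * chr \<theta> k)
        - c * cnj (v k * chr \<theta> k) + c * cnj c)"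
    proof (intro sum.cong refl)
      fix k
      have "chr (- \<theta>) k * chr \<theta> k = 1" using chr_mult_cnj[of "- \<theta>" k] by (simp add: cn)
      moreover have "cnj (chr \<theta> k) = chr (- \<theta>) k" by (simp add: chr_def cis_cnj)
      ultimately show "w k * cnj (w k) = v k * cnj (v k) - cnj c * (v k * chr \<theta> k)
          - c * cnj (v k * chr \<theta> k) + c * cnj c"
        unfolding w_def complex_cnj_diff complex_cnj_mult cn by algebra
    qed
    also have "\<dots> = (\<Sum>k\<in>V. v k * cnj (v k)) - cnj c * (\<Sum>k\<in>V. v k * chr \<theta> k)
        - c * cnj (\<Sum>k\<in>V. v k * chr \<theta> k) + card V * (c * cnj c)"
      by (simp add: sum.distrib sum_subtractf sum_distrib_left)
    also have "\<dots> = (\<Sum>k\<in>V. v k * cnj (v k)) - card V * (c * cnj c)"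
      unfolding c by simp
    also have "\<dots> = complex_of_real ((\<Sum>k\<in>V. (norm (v k))\<^sup>2) - card V * (norm c)\<^sup>2)"
      by (simp only: of_real_sum complex_norm_square of_real_diff of_real_mult of_real_of_nat_eq)
    finally have en: "(\<Sum>k\<in>V. (norm (w k))\<^sup>2) = (\<Sum>k\<in>V. (norm (v k))\<^sup>2) - card V * (norm c)\<^sup>2"
      using of_real_eq_iff by blast
    \<comment> \<open>Nonnegativity of the new energy bounds the removed coefficient by 1, so each
      removed character costs at most \<open>D\<close>.\<close>
    have "0 \<le> (\<Sum>k\<in>V. (norm (w k))\<^sup>2)" by (intro sum_nonneg) auto
    with en Suc.prems(2) have "card V * (norm c)\<^sup>2 \<le> card V * 1" by simp
    then have "(norm c)\<^sup>2 \<le> 1" using cV by (simp add: mult_le_cancel_left_pos)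
    then have c1: "norm c \<le> 1" by (simp add: power2_le_imp_le[of _ 1] abs_square_le_1)
    have "\<kappa>\<^sup>2 \<le> (norm c)\<^sup>2" using nc \<kappa> by (intro power_mono) auto
    then have "card V * \<kappa>\<^sup>2 \<le> card V * (norm c)\<^sup>2" by (intro mult_left_mono) auto
    then have "(\<Sum>k\<in>V. (norm (w k))\<^sup>2) \<le> real j * \<kappa>\<^sup>2 * card V"
      using en Suc.prems(1) by (simp add: algebra_simps)
    moreover have "(\<Sum>k\<in>V. (norm (w k))\<^sup>2) \<le> card V"
      unfolding en using Suc.prems(2) by (simp add: diff_le_eq add_increasing2)
    ultimately have "norm (\<Phi> w) \<le> C + real j * D" by (rule Suc.IH)
    moreover have "\<Phi> w = \<Phi> v - c * \<Phi> (chr (- \<theta>))"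
      unfolding w_def by (rule lin)
    then have "norm (\<Phi> v) \<le> norm (\<Phi> w) + norm c * norm (\<Phi> (chr (- \<theta>)))"
      by (metis diff_add_cancel norm_mult norm_triangle_ineq)
    moreover have "norm c * norm (\<Phi> (chr (- \<theta>))) \<le> 1 * D"
      using c1 char by (intro mult_mono) auto
    ultimately show ?thesis by (simp add: algebra_simps)
  qed
qed

section \<open>Bohr sets\<close>

text \<open>Only one half of the symmetric difference is measured; for finite \<open>B\<close> the
  other half has the same size, because translation preserves cardinality.\<close>

definition near_inv :: "real \<Rightarrow> int set \<Rightarrow> int \<Rightarrow> bool" where
  "near_inv \<epsilon> B k \<longleftrightarrow> real (card ((\<lambda>x. x + k) ` B - B)) \<le> \<epsilon> * real (card B)"

text \<open>The two sums agree on the common part of \<open>B\<close> and its translate. Each of the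
  two remaining pieces has at most \<open>\<epsilon> * card B\<close> points, hence the factor
  2.\<close>

lemma sum_shift_near_inv:
  fixes g :: "int \<Rightarrow> 'a::real_normed_vector"
  assumes B: "finite B" and inv: "near_inv \<epsilon> B k" and g: "\<And>x. norm (g x) \<le> 1"
  shows "norm ((\<Sum>x\<in>B. g (x + k)) - (\<Sum>x\<in>B. g x)) \<le> 2 * \<epsilon> * card B"
proof -
  let ?B' = "(\<lambda>x. x + k) ` B"
  have inj: "inj_on (\<lambda>x. x + k) B" by (simp add: inj_on_def)
  have fin: "finite ?B'" using B by simp
  have "(\<Sum>x\<in>B. g (x + k)) = (\<Sum>x\<in>?B'. g x)"
    by (simp add: sum.reindex[OF inj])
  also have "\<dots> = (\<Sum>x\<in>?B' - B. g x) + (\<Sum>x\<in>?B' \<inter> B. g x)"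
    using sum.Int_Diff[OF fin, of g B] by simp
  finally have 1: "(\<Sum>x\<in>B. g (x + k)) = (\<Sum>x\<in>?B' - B. g x) + (\<Sum>x\<in>?B' \<inter> B. g x)" .
  have 2: "(\<Sum>x\<in>B. g x) = (\<Sum>x\<in>B - ?B'. g x) + (\<Sum>x\<in>?B' \<inter> B. g x)"
    using sum.Int_Diff[OF B, of g ?B'] by (simp add: Int_commute)
  have "card (?B' - B) + card (?B' \<inter> B) = card ?B'"
    using card_Diff_subset_Int[of ?B' B] fin by (simp add: card_mono)
  moreover have "card (B - ?B') + card (?B' \<inter> B) = card B"
    using card_Diff_subset_Int[of B ?B'] B by (simp add: card_mono Int_commute)
  moreover have "card ?B' = card B" by (rule card_image[OF inj])
  ultimately have eq: "card (B - ?B') = card (?B' - B)" by simp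
  have b: "norm (\<Sum>x\<in>S. g x) \<le> card S" for S
    using sum_norm_bound[of S g 1] g by simp
  have "norm ((\<Sum>x\<in>B. g (x + k)) - (\<Sum>x\<in>B. g x))
      = norm ((\<Sum>x\<in>?B' - B. g x) - (\<Sum>x\<in>B - ?B'. g x))"
    by (simp add: 1 2)
  also have "\<dots> \<le> norm (\<Sum>x\<in>?B' - B. g x) + norm (\<Sum>x\<in>B - ?B'. g x)"
    by (rule norm_triangle_ineq4)
  also have "\<dots> \<le> card (?B' - B) + card (B - ?B')"
    using b[of "?B' - B"] b[of "B - ?B'"] by simp
  also have "\<dots> \<le> 2 * \<epsilon> * card B"
    using inv eq by (simp add: near_inv_def)
  finally show ?thesis .
qed

lemma sum_shifts_near_inv:
  fixes g :: "int \<Rightarrow> 'a::real_normed_vector"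
  assumes B: "finite B" and inv: "\<And>n. n \<in> C \<Longrightarrow> near_inv \<epsilon> B (h n)"
    and g: "\<And>x. norm (g x) \<le> 1"
  shows "norm ((\<Sum>n\<in>C. \<Sum>x\<in>B. g (x + h n)) - of_nat (card C) *\<^sub>R (\<Sum>x\<in>B. g x))
      \<le> 2 * \<epsilon> * card B * card C"
proof -
  have "(\<Sum>n\<in>C. \<Sum>x\<in>B. g (x + h n)) - of_nat (card C) *\<^sub>R (\<Sum>x\<in>B. g x)
      = (\<Sum>n\<in>C. (\<Sum>x\<in>B. g (x + h n)) - (\<Sum>x\<in>B. g x))"
    by (simp add: sum_subtractf sum_constant_scaleR)
  also have "norm \<dots> \<le> (\<Sum>n\<in>C. 2 * \<epsilon> * card B)"
    by (intro sum_norm_le sum_shift_near_inv B inv g)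
  finally show ?thesis by (simp add: mult.commute)
qed

text \<open>The bound on \<open>\<bar>n\<bar>\<close> plays the role of one more frequency.\<close>

definition bohr :: "nat \<Rightarrow> real set \<Rightarrow> real \<Rightarrow> int set" where
  "bohr N \<Gamma> \<rho> = {n. \<bar>real_of_int n\<bar> \<le> \<rho> * N \<and>
     (\<forall>\<gamma>\<in>\<Gamma>. \<exists>m::int. \<bar>\<gamma> * of_int n - of_int m\<bar> \<le> \<rho>)}"

lemma bohr_mono:
  assumes "\<rho> \<le> \<sigma>"
  shows "bohr N \<Gamma> \<rho> \<subseteq> bohr N \<Gamma> \<sigma>"
proof -
  have "\<rho> * N \<le> \<sigma> * N" using assms by (simp add: mult_right_mono)
  then show ?thesis using assms unfolding bohr_def by (blast intro: order_trans)
qed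

lemma bohr_antimono: "\<Gamma> \<subseteq> \<Delta> \<Longrightarrow> bohr N \<Delta> \<rho> \<subseteq> bohr N \<Gamma> \<rho>"
  unfolding bohr_def by blast

lemma bohr_subset_interval: "bohr N \<Gamma> \<rho> \<subseteq> {- \<lfloor>\<rho> * N\<rfloor>..\<lfloor>\<rho> * N\<rfloor>}"
  unfolding bohr_def by (auto simp: le_floor_iff minus_le_iff)

lemma finite_bohr [simp]: "finite (bohr N \<Gamma> \<rho>)"
  using bohr_subset_interval finite_atLeastAtMost_int by (rule finite_subset)

lemma zero_in_bohr [simp]: "0 \<le> \<rho> \<Longrightarrow> 0 \<in> bohr N \<Gamma> \<rho>"
  unfolding bohr_def by (auto intro!: exI[of _ "0::int"])

lemma card_bohr_pos: "0 \<le> \<rho> \<Longrightarrow> card (bohr N \<Gamma> \<rho>) > 0"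
  unfolding card_gt_0_iff using zero_in_bohr[of \<rho> N \<Gamma>] finite_bohr by blast

lemma bohr_add:
  assumes "x \<in> bohr N \<Gamma> \<rho>" "y \<in> bohr N \<Gamma> \<sigma>"
  shows "x + y \<in> bohr N \<Gamma> (\<rho> + \<sigma>)"
proof -
  have "\<exists>m::int. \<bar>\<gamma> * of_int (x + y) - of_int m\<bar> \<le> \<rho> + \<sigma>" if "\<gamma> \<in> \<Gamma>" for \<gamma>
  proof -
    obtain m l :: int where "\<bar>\<gamma> * of_int x - of_int m\<bar> \<le> \<rho>" "\<bar>\<gamma> * of_int y - of_int l\<bar> \<le> \<sigma>"
      using assms \<open>\<gamma> \<in> \<Gamma>\<close> unfolding bohr_def by blast
    then have "\<bar>\<gamma> * of_int (x + y) - of_int (m + l)\<bar> \<le> \<rho> + \<sigma>"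
      by (simp add: algebra_simps)
    then show ?thesis by blast
  qed
  moreover have "\<bar>real_of_int (x + y)\<bar> \<le> (\<rho> + \<sigma>) * N"
    using assms abs_triangle_ineq[of "real_of_int x" "real_of_int y"]
    unfolding bohr_def by (auto simp: distrib_right)
  ultimately show ?thesis unfolding bohr_def by blast
qed

lemma card_bohr_le:
  assumes "0 \<le> \<rho>" "\<rho> \<le> 2" "N \<ge> 1"
  shows "real (card (bohr N \<Gamma> \<rho>)) \<le> 5 * N"
proof -
  have "card (bohr N \<Gamma> \<rho>) \<le> card {- \<lfloor>\<rho> * N\<rfloor>..\<lfloor>\<rho> * N\<rfloor>}"
    by (intro card_mono bohr_subset_interval) simp
  also have "\<dots> = nat (2 * \<lfloor>\<rho> * N\<rfloor> + 1)" by simp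
  finally have "real (card (bohr N \<Gamma> \<rho>)) \<le> real (nat (2 * \<lfloor>\<rho> * N\<rfloor> + 1))" by simp
  also have "\<dots> = 2 * of_int \<lfloor>\<rho> * N\<rfloor> + 1" using assms by simp
  also have "\<dots> \<le> 2 * (\<rho> * N) + 1" using of_int_floor_le[of "\<rho> * N"] by linarith
  also have "\<dots> \<le> 2 * (2 * N) + 1" using assms by (simp add: mult_right_mono)
  also have "\<dots> \<le> 5 * N" using assms by simp
  finally show ?thesis by simp
qed

text \<open>Pigeonhole: for each frequency the circle is cut into \<open>m\<close> arcs, and the
  integers from 0 to \<open>N / m\<close> are sorted by arcs. Differences within a box of at least
  average size lie in the Bohr set. The extra 1 in the exponent pays for the restriction on
  \<open>\<bar>n\<bar>\<close>.\<close>

lemma card_bohr_ge: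
  fixes m :: nat
  assumes \<Gamma>: "finite \<Gamma>" and m: "m > 0"
  shows "real (card (bohr N \<Gamma> (1 / m))) \<ge> N / m ^ (card \<Gamma> + 1)"
proof -
  let ?S = "{0..\<lfloor>N / m\<rfloor>}"
  define \<phi> where "\<phi> n = (\<lambda>\<gamma>\<in>\<Gamma>. nat \<lfloor>m * frac (\<gamma> * real_of_int n)\<rfloor>)" for n
  have "\<phi> \<in> ?S \<rightarrow> (\<Gamma> \<rightarrow>\<^sub>E {..<m})"
  proof (intro Pi_I PiE_I)
    fix n \<gamma> assume "\<gamma> \<in> \<Gamma>"
    have "m * frac (\<gamma> * real_of_int n) < m"
      using m frac_lt_1[of "\<gamma> * real_of_int n"] by simp
    then show "\<phi> n \<gamma> \<in> {..<m}" using \<open>\<gamma> \<in> \<Gamma>\<close> m by (simp add: \<phi>_def nat_less_iff floor_less_iff)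
  qed (simp add: \<phi>_def)
  moreover have "\<Gamma> \<rightarrow>\<^sub>E {..<m} \<noteq> {}" using m by (auto simp: PiE_eq_empty_iff)
  ultimately obtain y where
    y: "card ?S \<le> card (\<phi> -` {y} \<inter> ?S) * card (\<Gamma> \<rightarrow>\<^sub>E {..<m})"
    using pigeonhole_card[of \<phi> ?S "\<Gamma> \<rightarrow>\<^sub>E {..<m}"] \<Gamma> by (auto intro: finite_PiE)
  let ?F = "\<phi> -` {y} \<inter> ?S"
  have "real (card ?S) = real_of_int (\<lfloor>N / m\<rfloor> + 1)" by simp
  then have S: "real (card ?S) \<ge> N / m" by linarith
  have cardP: "card (\<Gamma> \<rightarrow>\<^sub>E {..<m}) = m ^ card \<Gamma>" using \<Gamma> by (simp add: card_PiE)
  have F: "card ?F \<le> card (bohr N \<Gamma> (1 / m))"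
  proof (cases "?F = {}")
    case False
    then obtain n0 where n0: "n0 \<in> ?F" by blast
    have "(\<lambda>n. n - n0) ` ?F \<subseteq> bohr N \<Gamma> (1 / m)"
    proof clarify
      fix n assume n: "n \<in> ?S" "y = \<phi> n"
      then have eq: "\<phi> n = \<phi> n0" using n0 by simp
      have "\<bar>n - n0\<bar> \<le> \<lfloor>N / m\<rfloor>" using n n0 by auto
      then have "\<bar>real_of_int (n - n0)\<bar> \<le> 1 / m * N" by (simp add: le_floor_iff)
      moreover have "\<exists>l::int. \<bar>\<gamma> * of_int (n - n0) - of_int l\<bar> \<le> 1 / m" if "\<gamma> \<in> \<Gamma>" for \<gamma>
      proof -
        have "nat \<lfloor>m * frac (\<gamma> * n)\<rfloor> = nat \<lfloor>m * frac (\<gamma> * n0)\<rfloor>"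
          using fun_cong[OF eq, of \<gamma>] that by (simp add: \<phi>_def)
        then have "\<lfloor>m * frac (\<gamma> * n)\<rfloor> = \<lfloor>m * frac (\<gamma> * n0)\<rfloor>"
          by (subst (asm) eq_nat_nat_iff) (auto simp: frac_ge_0)
        then have "\<bar>m * frac (\<gamma> * n) - m * frac (\<gamma> * n0)\<bar> \<le> 1" by linarith
        then have "m * \<bar>frac (\<gamma> * n) - frac (\<gamma> * n0)\<bar> \<le> 1"
          by (simp add: abs_mult right_diff_distrib [symmetric])
        then have "\<bar>frac (\<gamma> * n) - frac (\<gamma> * n0)\<bar> \<le> 1 / m"
          using m by (simp add: field_simps)
        moreover have "frac (\<gamma> * n) - frac (\<gamma> * n0)
            = \<gamma> * of_int (n - n0) - of_int (\<lfloor>\<gamma> * n\<rfloor> - \<lfloor>\<gamma> * n0\<rfloor>)"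
          by (simp add: frac_def algebra_simps)
        ultimately show ?thesis by (intro exI[of _ "\<lfloor>\<gamma> * n\<rfloor> - \<lfloor>\<gamma> * n0\<rfloor>"]) simp
      qed
      ultimately show "n - n0 \<in> bohr N \<Gamma> (1 / m)" unfolding bohr_def by blast
    qed
    then have "card ((\<lambda>n. n - n0) ` ?F) \<le> card (bohr N \<Gamma> (1 / m))"
      by (intro card_mono) auto
    then show ?thesis by (simp add: card_image inj_on_def)
  qed simp
  have "card ?S \<le> card (bohr N \<Gamma> (1 / m)) * m ^ card \<Gamma>"
    using y mult_le_mono1[OF F] unfolding cardP by (rule order_trans)
  then have "N / m \<le> real (card (bohr N \<Gamma> (1 / m)) * m ^ card \<Gamma>)"
    using S by linarith
  then show ?thesis using m by (simp add: field_simps)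
qed

definition bohr_reg :: "real \<Rightarrow> nat \<Rightarrow> real set \<Rightarrow> real \<Rightarrow> real \<Rightarrow> bool" where
  "bohr_reg \<epsilon> N \<Gamma> \<rho> t \<longleftrightarrow>
     real (card (bohr N \<Gamma> (\<rho> + t))) \<le> (1 + \<epsilon>) * real (card (bohr N \<Gamma> \<rho>))"

lemma bohr_reg_mono:
  assumes "bohr_reg \<epsilon> N \<Gamma> \<rho> t" "u \<le> t"
  shows "bohr_reg \<epsilon> N \<Gamma> \<rho> u"
proof -
  have "card (bohr N \<Gamma> (\<rho> + u)) \<le> card (bohr N \<Gamma> (\<rho> + t))"
    using assms by (intro card_mono bohr_mono) auto
  then show ?thesis using assms(1) unfolding bohr_reg_def by linarith
qed

text \<open>The part of the translate outside the Bohr set lies in the shell between the radii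
  \<open>\<rho>\<close> and \<open>\<rho> + t\<close>, which regularity makes thin.\<close>

lemma near_inv_bohr:
  assumes reg: "bohr_reg \<epsilon> N \<Gamma> \<rho> t" and k: "k \<in> bohr N \<Gamma> t" and t: "0 \<le> t"
  shows "near_inv \<epsilon> (bohr N \<Gamma> \<rho>) k"
proof -
  let ?B = "bohr N \<Gamma> \<rho>"
  have "card ((\<lambda>x. x + k) ` ?B - ?B) \<le> card (bohr N \<Gamma> (\<rho> + t) - ?B)"
    using k bohr_add by (intro card_mono) auto
  also have "\<dots> = card (bohr N \<Gamma> (\<rho> + t)) - card ?B"
    using t by (intro card_Diff_subset bohr_mono) auto
  finally have "card ((\<lambda>x. x + k) ` ?B - ?B) \<le> card (bohr N \<Gamma> (\<rho> + t)) - card ?B" .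
  moreover have "card ?B \<le> card (bohr N \<Gamma> (\<rho> + t))"
    using t by (intro card_mono bohr_mono) auto
  ultimately have "real (card ((\<lambda>x. x + k) ` ?B - ?B)) \<le> card (bohr N \<Gamma> (\<rho> + t)) - real (card ?B)"
    by linarith
  then show ?thesis
    using reg unfolding near_inv_def bohr_reg_def by (simp add: algebra_simps)
qed

text \<open>The radii from \<open>r / 2\<close> to \<open>r\<close> are cut into \<open>K\<close>
  equal steps. If every step enlarged the Bohr set by more than the factor
  \<open>1 + \<epsilon>\<close>, its final size would exceed \<open>(1 + \<epsilon>) ^ K\<close> and
  hence the trivial bound \<open>5 * N\<close>. This takes a \<open>K\<close> of order
  \<open>log N / \<epsilon>\<close>, instead of one depending on the rank.\<close>

lemma exists_bohr_reg:
  assumes r: "0 < r" "r \<le> 2" and N: "N \<ge> 1" and K: "(1 + \<epsilon>) ^ K \<ge> 5 * N" "K > 0" and \<epsilon>: "\<epsilon> \<ge> 0"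
  obtains \<rho> where "r / 2 \<le> \<rho>" "\<rho> \<le> r" "bohr_reg \<epsilon> N \<Gamma> \<rho> (r / (2 * K))"
proof -
  define R where "R i = r / 2 + i * (r / (2 * K))" for i :: nat
  have R: "r / 2 \<le> R i" for i using r by (simp add: R_def)
  have RS: "R (Suc i) = R i + r / (2 * K)" for i
    unfolding R_def of_nat_Suc distrib_right by simp
  have RK: "R i \<le> r" if "i \<le> K" for i
  proof -
    have "i * (r / (2 * K)) \<le> K * (r / (2 * K))" using that r by (intro mult_right_mono) auto
    also have "\<dots> = r / 2" using K(2) by simp
    finally show ?thesis unfolding R_def by linarith
  qed
  have "\<exists>i<K. bohr_reg \<epsilon> N \<Gamma> (R i) (r / (2 * K))"
  proof (rule ccontr)
    assume "\<not> ?thesis"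
    then have step: "real (card (bohr N \<Gamma> (R (Suc i)))) > (1 + \<epsilon>) * real (card (bohr N \<Gamma> (R i)))" if "i < K" for i
      using that RS[of i] by (simp add: bohr_reg_def not_le)
    have ge: "real (card (bohr N \<Gamma> (R i))) \<ge> (1 + \<epsilon>) ^ i" if "i \<le> K" for i
      using that
    proof (induction i)
      case 0
      then show ?case using card_bohr_pos[of "R 0" N \<Gamma>] r R[of 0] by simp
    next
      case (Suc i)
      then have "(1 + \<epsilon>) * (1 + \<epsilon>) ^ i \<le> (1 + \<epsilon>) * real (card (bohr N \<Gamma> (R i)))"
        using \<epsilon> by (intro mult_left_mono) auto
      then show ?case using step[of i] Suc.prems by simp
    qed
    obtain j where j: "K = Suc j" using K(2) by (cases K) auto
    have "(1 + \<epsilon>) ^ K \<le> (1 + \<epsilon>) * real (card (bohr N \<Gamma> (R j)))"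
      using ge[of j] \<epsilon> j by (simp add: mult_left_mono)
    also have "\<dots> < real (card (bohr N \<Gamma> (R K)))" using step[of j] j by simp
    also have "\<dots> \<le> 5 * N" using R[of K] RK[of K] r N by (intro card_bohr_le) auto
    finally show False using K(1) by simp
  qed
  then obtain i where i: "i < K" "bohr_reg \<epsilon> N \<Gamma> (R i) (r / (2 * K))" by blast
  show ?thesis by (rule that[of "R i"]) (use R RK i in auto)
qed

section \<open>Cliques and local Fourier coefficients\<close>

lemma exists_ge_average:
  fixes Q :: "'a \<Rightarrow> real" and c :: real
  assumes "finite B" "B \<noteq> {}" "c * card B \<le> sum Q B"
  obtains b where "b \<in> B" "c \<le> Q b"
proof -
  have "\<exists>b\<in>B. c \<le> Q b"
  proof (rule ccontr)
    assume "\<not> ?thesis"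
    then have "sum Q B < (\<Sum>b\<in>B. c)"
      using assms(1,2) by (intro sum_strict_mono) (auto simp: not_le)
    then show False using assms(3) by (simp add: mult.commute)
  qed
  then show ?thesis using that by blast
qed

text \<open>Greedy selection: a vertex of at least average degree is chosen and \<open>W\<close> is
  replaced by its neighbourhood. The average degree is at least \<open>2 * p * card W\<close>; half
  of it absorbs the removal of the vertex itself, which may carry a loop, so each step costs at most
  a factor \<open>p\<close> in size. The condition on \<open>p ^ k\<close> keeps \<open>W\<close>
  above the threshold \<open>q\<close> while further vertices must be chosen.\<close>

lemma dense_graph_clique:
  fixes E :: "'a \<Rightarrow> 'a \<Rightarrow> bool" and p q :: real
  assumes sym: "\<And>x y. E x y \<Longrightarrow> E y x" and V: "finite V" and p: "0 < p" "p \<le> 1" and pq: "1 \<le> p * q"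
    and dense: "\<And>W. W \<subseteq> V \<Longrightarrow> q \<le> card W \<Longrightarrow>
      2 * p * (real (card W))\<^sup>2 \<le> (\<Sum>n\<in>W. \<Sum>m\<in>W. of_bool (E n m))"
    and W: "W \<subseteq> V" "p * q \<le> card W * p ^ k"
  shows "\<exists>C\<subseteq>W. card C = Suc k \<and> (\<forall>x\<in>C. \<forall>y\<in>C. x \<noteq> y \<longrightarrow> E x y)"
  using W
proof (induction k arbitrary: W)
  case 0
  then have "card W > 0" using pq by (cases "card W") auto
  then obtain x where "x \<in> W" by fastforce
  then show ?case by (intro exI[of _ "{x}"]) simp
next
  case (Suc k)
  have fW: "finite W" using Suc.prems V by (meson finite_subset)
  have "p * q \<le> p * (card W * p ^ k)" using Suc.prems by (simp add: algebra_simps)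
  then have "q \<le> card W * p ^ k" using p by simp
  also have "\<dots> \<le> real (card W) * 1" using p by (intro mult_left_mono power_le_one) auto
  finally have q: "q \<le> card W" by simp
  have pW: "1 \<le> p * card W" using pq mult_left_mono[OF q, of p] p by linarith
  then have "W \<noteq> {}" by auto
  have "2 * p * card W * card W \<le> (\<Sum>n\<in>W. \<Sum>m\<in>W. of_bool (E n m))"
    using dense[OF Suc.prems(1) q] by (simp add: power2_eq_square mult.assoc)
  then obtain n where n: "n \<in> W" "2 * p * card W \<le> (\<Sum>m\<in>W. of_bool (E n m))"
    by (rule exists_ge_average[OF fW \<open>W \<noteq> {}\<close>])
  define W' where "W' = {m\<in>W. E n m} - {n}"
  have "card {m\<in>W. E n m} \<le> card W' + 1"
    unfolding W'_def using fW by (simp add: card_Diff_singleton_if) linarith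
  moreover have "{m\<in>W. E n m} = W \<inter> {m. E n m}" by blast
  then have "(\<Sum>m\<in>W. of_bool (E n m)) = real (card {m\<in>W. E n m})"
    using fW by simp
  ultimately have "p * card W \<le> card W'" using n(2) pW by linarith
  then have "p * card W * p ^ k \<le> card W' * p ^ k" using p by (intro mult_right_mono) auto
  then have "p * q \<le> card W' * p ^ k" using Suc.prems(2) by (simp add: algebra_simps)
  moreover have "W' \<subseteq> V" using Suc.prems(1) by (auto simp: W'_def)
  ultimately obtain C where C: "C \<subseteq> W'" "card C = Suc k" "\<forall>x\<in>C. \<forall>y\<in>C. x \<noteq> y \<longrightarrow> E x y"
    using Suc.IH[of W'] by blast
  have "finite C" using C(2) card.infinite by fastforce
  moreover have "n \<notin> C" using C(1) by (auto simp: W'_def)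
  ultimately have "card (insert n C) = Suc (Suc k)" using C(2) by simp
  moreover have nE: "E n y" if "y \<in> C" for y
    using C(1) that by (auto simp: W'_def)
  then have "\<forall>x\<in>insert n C. \<forall>y\<in>insert n C. x \<noteq> y \<longrightarrow> E x y"
    using C(3) sym[OF nE] by auto
  moreover have "insert n C \<subseteq> W" using C(1) n(1) by (auto simp: W'_def)
  ultimately show ?case by blast
qed

lemma configuration_of_clique:
  assumes "card C = s" and "s > 0"
    and diag: "\<And>n. n \<in> C \<Longrightarrow> n + n + a \<in> A"
    and edge: "\<And>n m. n \<in> C \<Longrightarrow> m \<in> C \<Longrightarrow> n \<noteq> m \<Longrightarrow> n + m + a \<in> A"
  shows "contains_nontrivial_configuration s A"
proof -
  have "finite C" using assms(1,2) card_gt_0_iff by blast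
  then obtain h where h: "bij_betw h {1..s} C"
    using ex_bij_betw_nat_finite_1 assms(1) by blast
  have "configuration s h a \<subseteq> A"
  proof
    fix x assume "x \<in> configuration s h a"
    then obtain i j where ij: "x = h i + h j + a" "i \<in> {1..s}" "j \<in> {1..s}"
      by (auto simp: configuration_def)
    then have "h i \<in> C" "h j \<in> C" using h by (auto simp: bij_betw_def)
    then show "x \<in> A" using ij(1) diag edge by (cases "h i = h j") auto
  qed
  then show ?thesis
    using h unfolding contains_nontrivial_configuration_def bij_betw_def by blast
qed

section \<open>Choosing translates by averaging\<close>

text \<open>The diagonal must be rich in \<open>A\<close> while the mean of \<open>f\<close> over
  sums from \<open>B1\<close> is not very negative. Averaging \<open>b1 * G + W * H\<close> over
  \<open>B0\<close> gives both at once: the absence of an increment caps \<open>H\<close>, so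
  \<open>G\<close> is large, and the trivial cap on \<open>G\<close> then bounds \<open>H\<close>
  from below.\<close>

lemma choose_base_point:
  fixes A :: "int set" and \<alpha> \<tau> \<epsilon> W :: real
  defines "f x \<equiv> of_bool (x \<in> A) - \<alpha>"
  assumes B: "finite B0" "B0 \<noteq> {}" "finite B1" "B1 \<noteq> {}"
    and \<alpha>: "0 < \<alpha>" "\<alpha> \<le> 1" and W: "W > 0" "W * \<tau> \<le> \<alpha> / 4" "2 * \<epsilon> * (1 + W) \<le> \<alpha> / 4"
    and inv: "\<And>c n. c \<in> B1 \<Longrightarrow> n \<in> B1 \<Longrightarrow> near_inv \<epsilon> B0 (c + n)"
    and dens: "0 \<le> (\<Sum>x\<in>B0. f (x0 + x))"
    and noinc: "\<And>x. (\<Sum>n\<in>B1. f (x + n)) \<le> \<tau> * card B1"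
  obtains Y where "\<alpha> / 2 * card B1 \<le> card {n\<in>B1. n + n + Y \<in> A}"
    and "- ((real (card B1))\<^sup>2 / W) \<le> (\<Sum>c\<in>B1. \<Sum>n\<in>B1. f (Y + c + n))"
proof -
  define b0 b1 where "b0 = real (card B0)" "b1 = real (card B1)"
  have b: "b0 > 0" "b1 > 0" using B by (auto simp: b0_b1_def card_gt_0_iff)
  have f1: "\<bar>f x\<bar> \<le> 1" for x using \<alpha> by (simp add: f_def)
  define G where "G a = (\<Sum>n\<in>B1. of_bool (x0 + (a + (n + n)) \<in> A) :: real)" for a
  define H where "H a = (\<Sum>(c,n)\<in>B1\<times>B1. f (x0 + (a + (c + n))))" for a
  have dens': "\<alpha> * b0 \<le> (\<Sum>x\<in>B0. of_bool (x0 + x \<in> A))"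
    using dens by (simp add: f_def sum_subtractf b0_b1_def mult.commute)
  \<comment> \<open>For each fixed \<open>n\<close> the shift by \<open>n + n\<close> is averaged
    over \<open>B0\<close>, so the sparseness of the doubles \<open>n + n\<close> causes no
    loss.\<close>
  have "(\<Sum>n\<in>B1. \<Sum>a\<in>B0. of_bool (x0 + (a + (n + n)) \<in> A) :: real)
      \<ge> b1 * (\<Sum>x\<in>B0. of_bool (x0 + x \<in> A)) - 2 * \<epsilon> * b0 * b1"
    using sum_shifts_near_inv[OF B(1), of B1 \<epsilon> "\<lambda>n. n + n" "\<lambda>x. of_bool (x0 + x \<in> A) :: real",
        OF inv]
    by (simp add: b0_b1_def abs_le_iff)
  moreover have "b1 * (\<Sum>x\<in>B0. of_bool (x0 + x \<in> A)) \<ge> b1 * (\<alpha> * b0)"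
    using b dens' by (intro mult_left_mono) auto
  ultimately have G: "sum G B0 \<ge> (\<alpha> - 2 * \<epsilon>) * b0 * b1"
    unfolding G_def by (subst sum.swap) (simp add: algebra_simps)
  have "(\<Sum>p\<in>B1\<times>B1. \<Sum>a\<in>B0. f (x0 + (a + (fst p + snd p))))
      \<ge> card (B1 \<times> B1) * (\<Sum>x\<in>B0. f (x0 + x)) - 2 * \<epsilon> * b0 * card (B1 \<times> B1)"
    using sum_shifts_near_inv[OF B(1), of "B1 \<times> B1" \<epsilon> "\<lambda>p. fst p + snd p" "\<lambda>x. f (x0 + x)"] inv f1
    by (auto simp: b0_b1_def abs_le_iff)
  moreover have "card (B1 \<times> B1) * (\<Sum>x\<in>B0. f (x0 + x)) \<ge> 0"
    using dens by (intro mult_nonneg_nonneg) auto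
  ultimately have H: "sum H B0 \<ge> - 2 * \<epsilon> * b0 * (b1 * b1)"
    unfolding H_def case_prod_unfold by (subst sum.swap) (simp add: card_cartesian_product b0_b1_def)
  have "(3 * \<alpha> / 4) * (b1 * b1 * b0) \<le> (\<alpha> - 2 * \<epsilon> * (1 + W)) * (b1 * b1 * b0)"
    using W(3) b by (intro mult_right_mono) auto
  also have "\<dots> = b1 * ((\<alpha> - 2 * \<epsilon>) * b0 * b1) + W * (- 2 * \<epsilon> * b0 * (b1 * b1))"
    by (simp add: algebra_simps)
  also have "\<dots> \<le> b1 * sum G B0 + W * sum H B0"
    using G H b W(1) by (intro add_mono mult_left_mono) auto
  also have "\<dots> = (\<Sum>a\<in>B0. b1 * G a + W * H a)"
    by (simp add: sum.distrib sum_distrib_left)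
  finally have "(3 * \<alpha> / 4 * b1 * b1) * card B0 \<le> (\<Sum>a\<in>B0. b1 * G a + W * H a)"
    by (simp add: b0_b1_def mult.assoc)
  from exists_ge_average[OF B(1,2) this] obtain a where
    a: "3 * \<alpha> / 4 * b1 * b1 \<le> b1 * G a + W * H a" by blast
  have H_eq: "H a = (\<Sum>c\<in>B1. \<Sum>n\<in>B1. f (x0 + a + c + n))"
    by (simp add: H_def sum.cartesian_product add.assoc)
  have "H a \<le> (\<Sum>c\<in>B1. \<tau> * card B1)"
    unfolding H_eq by (intro sum_mono noinc)
  then have "W * H a \<le> W * (b1 * (\<tau> * b1))" using W(1) by (simp add: b0_b1_def)
  also have "\<dots> = (W * \<tau>) * (b1 * b1)" by simp
  also have "\<dots> \<le> \<alpha> / 4 * (b1 * b1)" using W(2) b by (intro mult_right_mono) auto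
  finally have "b1 * (\<alpha> / 2 * b1) \<le> b1 * G a" using a by (simp add: algebra_simps)
  then have "\<alpha> / 2 * b1 \<le> G a" using b by simp
  also have "{n\<in>B1. n + n + (x0 + a) \<in> A} = B1 \<inter> {n. x0 + (a + (n + n)) \<in> A}"
    by (auto simp: ac_simps)
  then have "G a = card {n\<in>B1. n + n + (x0 + a) \<in> A}"
    unfolding G_def using B(3) by simp
  finally have 1: "\<alpha> / 2 * card B1 \<le> card {n\<in>B1. n + n + (x0 + a) \<in> A}"
    by (simp add: b0_b1_def)
  have "G a \<le> b1" unfolding G_def b0_b1_def
    using sum_bounded_above[of B1 "\<lambda>n. of_bool (x0 + (a + (n + n)) \<in> A)" "1::real"] by simp
  then have "b1 * G a \<le> b1 * b1" using b by simp
  moreover have "0 \<le> 3 * \<alpha> / 4 * b1 * b1" using \<alpha> b by simp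
  ultimately have "- (b1 * b1) \<le> W * H a" using a by linarith
  then have "- ((real (card B1))\<^sup>2 / W) \<le> H a"
    using W(1) by (simp add: b0_b1_def power2_eq_square field_simps)
  then show ?thesis using 1 H_eq that by simp
qed

text \<open>Contrapositive of the clique lemma with \<open>p = \<alpha> / 4\<close>, so that
  \<open>2 * p\<close> is half the expected density. The vertices satisfy
  \<open>n + n + Y \<in> A\<close>, which supplies the terms with equal indices, so a clique of
  \<open>s\<close> vertices is a configuration.\<close>

lemma no_configuration_imp_sparse_subset:
  fixes A :: "int set" and \<alpha> q :: real
  assumes noconf: "\<not> contains_nontrivial_configuration s A" and s: "s \<ge> 2"
    and B: "finite B" and \<alpha>: "0 < \<alpha>" "\<alpha> \<le> 1"
    and q: "1 \<le> \<alpha> / 4 * q" "q \<le> (\<alpha> / 4) ^ (s - 1) * card B"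
    and dense: "\<alpha> / 2 * card B \<le> card {n\<in>B. n + n + Y \<in> A}"
  obtains V where "V \<subseteq> B" "q \<le> card V"
    and "(\<Sum>n\<in>V. \<Sum>m\<in>V. of_bool (n + m + Y \<in> A)) < \<alpha> / 2 * (real (card V))\<^sup>2"
proof -
  let ?V = "{n\<in>B. n + n + Y \<in> A}"
  let ?E = "\<lambda>n m. n + m + Y \<in> A"
  obtain k where k: "s = Suc (Suc k)" using s by (intro that[of "s - 2"]) simp
  have "\<alpha> / 4 * q \<le> \<alpha> / 4 * ((\<alpha> / 4) ^ (s - 1) * card B)"
    using \<alpha> q by (intro mult_left_mono) auto
  also have "\<dots> \<le> \<alpha> / 2 * ((\<alpha> / 4) ^ (s - 1) * card B)"
    using \<alpha> by (intro mult_right_mono) auto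
  also have "\<dots> \<le> card ?V * (\<alpha> / 4) ^ (s - 1)"
    using mult_right_mono[OF dense, of "(\<alpha> / 4) ^ (s - 1)"] \<alpha> by (simp add: ac_simps)
  finally have large: "\<alpha> / 4 * q \<le> card ?V * (\<alpha> / 4) ^ Suc k" by (simp add: k)
  have "\<exists>W\<subseteq>?V. q \<le> card W \<and> \<not> 2 * (\<alpha> / 4) * (real (card W))\<^sup>2 \<le> (\<Sum>n\<in>W. \<Sum>m\<in>W. of_bool (?E n m))"
  proof (rule ccontr)
    assume "\<not> ?thesis"
    then have *: "2 * (\<alpha> / 4) * (real (card W))\<^sup>2 \<le> (\<Sum>n\<in>W. \<Sum>m\<in>W. of_bool (?E n m))"
      if "W \<subseteq> ?V" "q \<le> card W" for W
      using that by blast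
    have "\<exists>C\<subseteq>?V. card C = Suc (Suc k) \<and> (\<forall>x\<in>C. \<forall>y\<in>C. x \<noteq> y \<longrightarrow> ?E x y)"
    proof (rule dense_graph_clique[where p = "\<alpha> / 4" and q = q and V = ?V])
      show "?E x y \<Longrightarrow> ?E y x" for x y by (simp add: add.commute)
      show "finite ?V" using B by simp
      show "0 < \<alpha> / 4" "\<alpha> / 4 \<le> 1" using \<alpha> by auto
    qed (use q(1) large * in blast)+
    then obtain C where C: "C \<subseteq> ?V" "card C = s" "\<forall>x\<in>C. \<forall>y\<in>C. x \<noteq> y \<longrightarrow> ?E x y"
      using k by blast
    then have "contains_nontrivial_configuration s A"
      using s by (intro configuration_of_clique[of C s Y A]) auto
    with noconf show False by blast
  qed
  then obtain W where "W \<subseteq> ?V" "q \<le> card W"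
    "(\<Sum>n\<in>W. \<Sum>m\<in>W. of_bool (?E n m)) < \<alpha> / 2 * (real (card W))\<^sup>2"
    by (auto simp: not_le)
  then show ?thesis using that[of W] by blast
qed

text \<open>The two variables are put at different scales because the bilinear Fourier bound loses a factor
  \<open>card (U + V) / card U\<close>, which is only bounded when \<open>U\<close> is nearly invariant under \<open>V\<close>. The weight
  \<open>W'\<close> ensures that the centre \<open>c\<close> found by averaging does not have low density.\<close>

lemma localise_bias:
  fixes f :: "int \<Rightarrow> real" and \<eta> \<tau> \<epsilon> W W' :: real
  assumes B: "finite B1" "B1 \<noteq> {}" "finite B2" "B2 \<noteq> {}" and V: "V \<subseteq> B1"
    and f1: "\<And>x. \<bar>f x\<bar> \<le> 1" and \<eta>: "0 < \<eta>" "\<eta> \<le> 1"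
    and W: "0 < W" "0 < W'" "W' / W \<le> \<eta> / 8" "W' * \<tau> \<le> \<eta> / 4" "2 * \<epsilon> \<le> \<eta> / 8"
    and inv: "\<And>k. k \<in> B2 \<Longrightarrow> near_inv \<epsilon> B1 k"
    and noinc: "\<And>x. (\<Sum>n\<in>B1. f (x + n)) \<le> \<tau> * card B1"
    and mean: "- ((real (card B1))\<^sup>2 / W) \<le> (\<Sum>c\<in>B1. \<Sum>n\<in>B1. f (Y + c + n))"
    and bias: "(\<Sum>n\<in>V. \<Sum>m\<in>V. f (n + m + Y)) \<le> - \<eta> * (real (card B1))\<^sup>2"
  obtains c where
    "(\<Sum>n\<in>V. \<Sum>k\<in>B2. of_bool (c + k \<in> V) * f (Y + c + (n + k))) \<le> - (\<eta> / 2) * card B1 * card B2"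
    and "- (card B1 / W') \<le> (\<Sum>n\<in>B1. f (Y + c + n))"
proof -
  define b1 b2 where "b1 = real (card B1)" "b2 = real (card B2)"
  have b: "b1 > 0" "b2 > 0" using B by (auto simp: b1_b2_def card_gt_0_iff)
  have fV: "finite V" using V B(1) by (rule finite_subset)
  have cV: "real (card V) \<le> b1" using card_mono[OF B(1) V] by (simp add: b1_b2_def)
  \<comment> \<open>The contribution of the second variable \<open>x\<close> to the bias, divided by
    \<open>b1\<close> to be bounded by 1 as the shift lemma requires.\<close>
  define g where "g x = of_bool (x \<in> V) * (\<Sum>n\<in>V. f (Y + (n + x))) / b1" for x
  have g1: "norm (g x) \<le> 1" for x
  proof -
    have "\<bar>\<Sum>n\<in>V. f (Y + (n + x))\<bar> \<le> card V"
      using sum_norm_bound[of V "\<lambda>n. f (Y + (n + x))" 1] f1 by simp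
    then show ?thesis using cV b by (simp add: g_def abs_mult)
  qed
  have "sum g B1 = sum g V"
    using V B(1) by (intro sum.mono_neutral_right) (auto simp: g_def)
  also have "\<dots> = (\<Sum>m\<in>V. \<Sum>n\<in>V. f (n + m + Y)) / b1"
    by (simp add: g_def sum_divide_distrib ac_simps)
  also have "\<dots> \<le> - \<eta> * b1"
    using bias b by (subst (asm) sum.swap) (simp add: b1_b2_def field_simps power2_eq_square)
  finally have gB: "b2 * sum g B1 \<le> b2 * (- \<eta> * b1)"
    using b by (intro mult_left_mono) auto
  have "(\<Sum>k\<in>B2. \<Sum>c\<in>B1. g (c + k)) \<le> b2 * sum g B1 + 2 * \<epsilon> * b1 * b2"
    using sum_shifts_near_inv[OF B(1), of B2 \<epsilon> "\<lambda>k. k" g, OF inv g1]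
    by (simp add: b1_b2_def abs_le_iff)
  also have "2 * \<epsilon> * b1 * b2 \<le> \<eta> / 8 * (b1 * b2)"
    using mult_right_mono[OF W(5), of "b1 * b2"] b by (simp add: mult.assoc)
  also note gB
  finally have g: "(\<Sum>k\<in>B2. \<Sum>c\<in>B1. g (c + k)) \<le> - (7 / 8 * \<eta>) * b1 * b2"
    by (simp add: algebra_simps)
  define S where "S c = (\<Sum>n\<in>V. \<Sum>k\<in>B2. of_bool (c + k \<in> V) * f (Y + c + (n + k)))" for c
  define h where "h c = (\<Sum>n\<in>B1. f (Y + c + n))" for c
  have S_eq: "S c = b1 * (\<Sum>k\<in>B2. g (c + k))" for c
  proof -
    have "b1 * g x = (\<Sum>n\<in>V. of_bool (x \<in> V) * f (Y + (n + x)))" for x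
      using b by (simp add: g_def sum_distrib_left [symmetric])
    then show ?thesis
      unfolding S_def sum_distrib_left by (subst sum.swap) (simp add: ac_simps)
  qed
  \<comment> \<open>The quantity averaged is \<open>W' * b2 * h c - S c\<close>. As
    \<open>h c\<close> is capped above, a large value forces \<open>S c\<close> to be very negative;
    the trivial bound on \<open>S c\<close> then keeps \<open>h c\<close> from being very negative.
    Of the initial \<open>\<eta>\<close>, the shift loses 1/8, the mean 1/8 and the cap 1/4, which
    leaves \<open>\<eta> / 2\<close>.\<close>
  have "(3 / 4 * \<eta> * b1 * b2) * card B1
      = - (\<eta> / 8 * (b1 * b1 * b2)) - b1 * (- (7 / 8 * \<eta>) * b1 * b2)"
    by (simp add: b1_b2_def algebra_simps)
  also have "\<dots> \<le> - (W' / W * (b1 * b1 * b2)) - b1 * (- (7 / 8 * \<eta>) * b1 * b2)"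
  proof -
    have "W' / W * (b1 * b1 * b2) \<le> \<eta> / 8 * (b1 * b1 * b2)"
      using b by (intro mult_right_mono W(3)) auto
    then show ?thesis by linarith
  qed
  also have "- (W' / W * (b1 * b1 * b2)) = W' * b2 * (- (b1\<^sup>2 / W))"
    by (simp add: power2_eq_square)
  also have "W' * b2 * (- (b1\<^sup>2 / W)) - b1 * (- (7 / 8 * \<eta>) * b1 * b2)
      \<le> W' * b2 * sum h B1 - b1 * (\<Sum>k\<in>B2. \<Sum>c\<in>B1. g (c + k))"
    using g b W mean unfolding h_def b1_b2_def
    by (intro diff_mono mult_left_mono) (auto simp: b1_b2_def)
  also have "\<dots> = (\<Sum>c\<in>B1. W' * b2 * h c - S c)"
    unfolding S_eq sum_subtractf sum_distrib_left [symmetric] by (subst sum.swap) simp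
  finally obtain c where c: "3 / 4 * \<eta> * b1 * b2 \<le> W' * b2 * h c - S c"
    by (rule exists_ge_average[OF B(1,2)])
  have "W' * b2 * h c \<le> W' * b2 * (\<tau> * b1)"
    using W(2) b noinc[of "Y + c"] unfolding h_def b1_b2_def by (intro mult_left_mono) auto
  also have "\<dots> = W' * \<tau> * (b1 * b2)" by simp
  also have "\<dots> \<le> \<eta> / 4 * (b1 * b2)" using W(4) b by (intro mult_right_mono) auto
  finally have 1: "S c \<le> - (\<eta> / 2) * b1 * b2" using c by (simp add: algebra_simps)
  have "\<bar>S c\<bar> \<le> (\<Sum>n\<in>V. \<Sum>k\<in>B2. \<bar>of_bool (c + k \<in> V) * f (Y + c + (n + k))\<bar>)"
    unfolding S_def by (intro order_trans[OF sum_abs] sum_mono sum_abs)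
  also have "\<dots> \<le> (\<Sum>n\<in>V. \<Sum>k\<in>B2. 1)"
    by (intro sum_mono) (simp add: f1)
  also have "\<dots> \<le> b1 * b2" using cV b by (simp add: b1_b2_def mult_right_mono)
  finally have "\<bar>S c\<bar> \<le> b1 * b2" .
  moreover have "0 \<le> 3 / 4 * \<eta> * b1 * b2" using b \<eta> by simp
  ultimately have "- (b1 * b2) \<le> W' * b2 * h c" using c by linarith
  also have "\<dots> = W' * h c * b2" by simp
  finally have "- b1 * b2 \<le> W' * h c * b2" by simp
  then have "- b1 \<le> W' * h c" using b(2) by (rule mult_right_le_imp_le)
  then have "- (b1 / W') \<le> h c" using W(2) by (simp add: field_simps)
  with 1 show ?thesis unfolding S_def h_def b1_b2_def by (rule that)
qed

section \<open>From bias to correlation with a character and to larger density\<close>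

text \<open>If all local coefficients were below \<open>D\<close>, the form \<open>\<Phi>\<close>
  would be small on characters; on uniform functions it is small because
  \<open>card S \<le> 2 * card B1\<close>. The energy decrement then contradicts the bias. Taking
  norms inside the sum lets the sum over \<open>V\<close> be enlarged to one over
  \<open>B1\<close>.\<close>

lemma bias_imp_local_fourier_coefficient:
  fixes F :: "int \<Rightarrow> real" and \<eta> :: real
  assumes B: "finite B1" "finite B2" "B2 \<noteq> {}" "finite S" and V: "V \<subseteq> B1"
    and F1: "\<And>x. \<bar>F x\<bar> \<le> 1" and \<eta>: "0 < \<eta>" "\<eta> \<le> 1" and v1: "\<And>k. \<bar>v k\<bar> \<le> 1"
    and S: "\<And>n k. n \<in> B1 \<Longrightarrow> k \<in> B2 \<Longrightarrow> n + k \<in> S" "card S \<le> 2 * card B1" and B1: "B1 \<noteq> {}"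
    and bias: "\<eta> / 2 * card B1 * card B2 \<le> \<bar>\<Sum>n\<in>V. \<Sum>k\<in>B2. v k * F (n + k)\<bar>"
  obtains \<theta> where
    "\<eta> ^ 3 / 4096 * card B1 * card B2 \<le> (\<Sum>n\<in>B1. norm (\<Sum>k\<in>B2. chr \<theta> k * of_real (F (n + k))))"
proof -
  define b1 b2 where "b1 = real (card B1)" "b2 = real (card B2)"
  have b: "b1 > 0" "b2 > 0" using B B1 by (auto simp: b1_b2_def card_gt_0_iff)
  have fV: "finite V" using V B(1) by (rule finite_subset)
  have cV: "real (card V) \<le> b1" using card_mono[OF B(1) V] by (simp add: b1_b2_def)
  have cS: "real (card S) \<le> 2 * b1" using S(2) by (simp add: b1_b2_def)
  define D where "D = \<eta> ^ 3 / 4096 * b1 * b2"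
  define \<Phi> where "\<Phi> w = (\<Sum>n\<in>V. \<Sum>k\<in>B2. w k * complex_of_real (F (n + k)))" for w
  \<comment> \<open>With this \<open>\<kappa>\<close> the uniform part contributes
    \<open>3 * \<eta> / 32\<close>, and at most \<open>512 / \<eta>\<^sup>2\<close> characters
    costing \<open>D\<close> each contribute \<open>\<eta> / 8\<close>. Together they fall short of
    \<open>\<eta> / 2\<close>.\<close>
  define \<kappa> where "\<kappa> = \<eta> / 16"
  define j where "j = nat \<lceil>1 / \<kappa>\<^sup>2\<rceil>"
  have \<kappa>: "0 < \<kappa>" "\<kappa> \<le> 1" using \<eta> by (auto simp: \<kappa>_def)
  then have k1: "1 \<le> 1 / \<kappa>\<^sup>2" by (simp add: power_le_one)
  then have j: "1 / \<kappa>\<^sup>2 \<le> j" "j \<le> 1 / \<kappa>\<^sup>2 + 1"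
    unfolding j_def by linarith+
  have jk: "1 \<le> real j * \<kappa>\<^sup>2" using j(1) \<kappa> by (simp add: field_simps)
  have "\<exists>\<theta>. D \<le> (\<Sum>n\<in>B1. norm (\<Sum>k\<in>B2. chr \<theta> k * of_real (F (n + k))))"
  proof (rule ccontr)
    assume "\<not> ?thesis"
    then have small: "(\<Sum>n\<in>B1. norm (\<Sum>k\<in>B2. chr \<theta> k * of_real (F (n + k)))) \<le> D" for \<theta>
      by (meson not_le less_imp_le)
    have en: "(\<Sum>k\<in>B2. (norm (complex_of_real (v k)))\<^sup>2) \<le> b2"
      using sum_bounded_above[of B2 "\<lambda>k. (norm (complex_of_real (v k)))\<^sup>2" 1] v1
      by (simp add: b1_b2_def abs_square_le_1)
    have "norm (\<Phi> (\<lambda>k. complex_of_real (v k))) \<le> \<kappa> * b2 * (b1 + 2 * b1) / 2 + real j * D"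
    proof (rule form_bound_by_characters[where \<Phi> = \<Phi> and V = B2 and \<kappa> = \<kappa>
          and v = "\<lambda>k. complex_of_real (v k)"])
      show "\<Phi> (\<lambda>k. w k - c * w' k) = \<Phi> w - c * \<Phi> w'" for w w' c
        unfolding \<Phi>_def by (simp add: left_diff_distrib sum_subtractf sum_distrib_left mult.assoc)
      show "norm (\<Phi> (chr \<theta>)) \<le> D" for \<theta>
      proof -
        have "norm (\<Phi> (chr \<theta>)) \<le> (\<Sum>n\<in>V. norm (\<Sum>k\<in>B2. chr \<theta> k * of_real (F (n + k))))"
          unfolding \<Phi>_def by (rule norm_sum)
        also have "\<dots> \<le> (\<Sum>n\<in>B1. norm (\<Sum>k\<in>B2. chr \<theta> k * of_real (F (n + k))))"
          using V B(1) by (intro sum_mono2) auto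
        finally show ?thesis using small[of \<theta>] by linarith
      qed
      show "norm (\<Phi> w) \<le> \<kappa> * b2 * (b1 + 2 * b1) / 2"
        if "\<And>\<theta>. norm (\<Sum>k\<in>B2. w k * chr \<theta> k) \<le> \<kappa> * card B2" for w
      proof -
        have "norm (\<Sum>n\<in>V. \<Sum>k\<in>B2. 1 * w k * complex_of_real (F (n + k)))
            \<le> \<kappa> * card B2 * (real (card V) + real (card S)) / 2"
          by (rule bilinear_fourier_bound) (use fV B V S(1) that F1 in auto)
        also have "\<dots> \<le> \<kappa> * b2 * (b1 + 2 * b1) / 2"
          using cV cS \<kappa> by (intro divide_right_mono mult_mono add_mono) (auto simp: b1_b2_def)
        finally show ?thesis by (simp add: \<Phi>_def)
      qed
      show "0 \<le> D" using b \<eta> by (simp add: D_def)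
      show "(\<Sum>k\<in>B2. (norm (complex_of_real (v k)))\<^sup>2) \<le> real j * \<kappa>\<^sup>2 * card B2"
        using en mult_right_mono[OF jk, of b2] b unfolding b1_b2_def by linarith
    qed (use B \<kappa> en in \<open>auto simp: b1_b2_def\<close>)
    moreover have "\<Phi> (\<lambda>k. complex_of_real (v k)) = complex_of_real (\<Sum>n\<in>V. \<Sum>k\<in>B2. v k * F (n + k))"
      unfolding \<Phi>_def by simp
    then have "norm (\<Phi> (\<lambda>k. complex_of_real (v k))) = \<bar>\<Sum>n\<in>V. \<Sum>k\<in>B2. v k * F (n + k)\<bar>"
      by (simp only: norm_of_real)
    ultimately have "\<eta> / 2 * b1 * b2 \<le> \<kappa> * b2 * (b1 + 2 * b1) / 2 + real j * D"
      using bias unfolding b1_b2_def by linarith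
    also have "real j * D \<le> (512 / \<eta>\<^sup>2) * D"
    proof (intro mult_right_mono)
      have "1 / \<kappa>\<^sup>2 = 256 / \<eta>\<^sup>2" by (simp add: \<kappa>_def power_divide)
      then show "real j \<le> 512 / \<eta>\<^sup>2" using j(2) k1 by simp
    qed (use b \<eta> in \<open>simp add: D_def\<close>)
    also have "(512 / \<eta>\<^sup>2) * D = \<eta> / 8 * (b1 * b2)"
      using \<eta> by (simp add: D_def power2_eq_square power3_eq_cube)
    also have "\<kappa> * b2 * (b1 + 2 * b1) / 2 = 3 * \<eta> / 32 * (b1 * b2)"
      by (simp add: \<kappa>_def)
    finally have "\<eta> / 2 * (b1 * b2) \<le> (3 * \<eta> / 32 + \<eta> / 8) * (b1 * b2)"
      by (simp add: algebra_simps)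
    moreover have "(3 * \<eta> / 32 + \<eta> / 8) * (b1 * b2) < \<eta> / 2 * (b1 * b2)"
      using b \<eta> by (intro mult_strict_right_mono) auto
    ultimately show False by linarith
  qed
  then show ?thesis using that unfolding D_def b1_b2_def by blast
qed

text \<open>\<open>chr \<theta>\<close> is nearly constant on translates of \<open>B3\<close>, so
  the local coefficients are controlled by the mean of \<open>\<bar>T\<bar>\<close>. Absolute values
  carry no sign, but the mean of \<open>T\<close> itself is not very negative; hence
  \<open>\<bar>T\<bar> + T\<close> has a large mean and \<open>T\<close> is large somewhere.\<close>

lemma local_fourier_coefficient_imp_increment:
  fixes F :: "int \<Rightarrow> real" and \<theta> \<epsilon> \<rho> \<sigma> :: real
  assumes B: "finite B1" "B1 \<noteq> {}" "finite B2" "B2 \<noteq> {}" "finite B3" "B3 \<noteq> {}"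
    and F1: "\<And>x. \<bar>F x\<bar> \<le> 1"
    and inv1: "\<And>k l. k \<in> B2 \<Longrightarrow> l \<in> B3 \<Longrightarrow> near_inv \<epsilon> B1 (k + l)"
    and inv2: "\<And>l. l \<in> B3 \<Longrightarrow> near_inv \<epsilon> B2 l"
    and \<theta>: "\<And>l. l \<in> B3 \<Longrightarrow> norm (chr \<theta> l - 1) \<le> \<rho>"
    and four: "\<sigma> * card B1 * card B2 \<le> (\<Sum>n\<in>B1. norm (\<Sum>k\<in>B2. chr \<theta> k * of_real (F (n + k))))"
    and mean: "- (\<sigma> / 4) * card B1 \<le> (\<Sum>n\<in>B1. F n)"
    and small: "4 * \<epsilon> + \<rho> \<le> \<sigma> / 4" and \<sigma>: "0 < \<sigma>"
  obtains x where "\<sigma> / 4 * card B3 \<le> (\<Sum>l\<in>B3. F (x + l))"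
proof -
  define b1 b2 b3 where "b1 = real (card B1)" "b2 = real (card B2)" "b3 = real (card B3)"
  note b_def = b1_b2_b3_def
  have b: "b1 > 0" "b2 > 0" "b3 > 0" using B by (auto simp: b_def card_gt_0_iff)
  define T where "T x = (\<Sum>l\<in>B3. F (x + l))" for x
  have shift: "b3 * norm (\<Sum>k\<in>B2. chr \<theta> k * of_real (F (n + k)))
      \<le> (\<Sum>k\<in>B2. \<bar>T (n + k)\<bar>) + (2 * \<epsilon> + \<rho>) * b2 * b3" for n
  proof -
    let ?g = "\<lambda>k. chr \<theta> k * complex_of_real (F (n + k))"
    have "norm ((\<Sum>l\<in>B3. \<Sum>k\<in>B2. ?g (k + l)) - of_nat (card B3) *\<^sub>R (\<Sum>k\<in>B2. ?g k))
        \<le> 2 * \<epsilon> * card B2 * card B3"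
      using sum_shifts_near_inv[OF B(3), of B3 \<epsilon> "\<lambda>l. l" ?g] inv2 F1 by (simp add: norm_mult)
    then have "norm (of_nat (card B3) *\<^sub>R (\<Sum>k\<in>B2. ?g k))
        \<le> norm (\<Sum>l\<in>B3. \<Sum>k\<in>B2. ?g (k + l)) + 2 * \<epsilon> * card B2 * card B3"
      using norm_triangle_sub[of "of_nat (card B3) *\<^sub>R (\<Sum>k\<in>B2. ?g k)" "\<Sum>l\<in>B3. \<Sum>k\<in>B2. ?g (k + l)"]
      by (simp add: norm_minus_commute)
    then have 1: "b3 * norm (\<Sum>k\<in>B2. ?g k)
        \<le> norm (\<Sum>l\<in>B3. \<Sum>k\<in>B2. ?g (k + l)) + 2 * \<epsilon> * b2 * b3"
      by (simp add: b_def norm_mult)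
    have split: "(\<Sum>l\<in>B3. \<Sum>k\<in>B2. ?g (k + l))
        = (\<Sum>k\<in>B2. \<Sum>l\<in>B3. chr \<theta> k * of_real (F (n + k + l)))
          + (\<Sum>l\<in>B3. \<Sum>k\<in>B2. (chr \<theta> l - 1) * (chr \<theta> k * of_real (F (n + k + l))))"
    proof -
      have "?g (k + l) = chr \<theta> k * of_real (F (n + k + l))
          + (chr \<theta> l - 1) * (chr \<theta> k * of_real (F (n + k + l)))" for k l
        by (simp add: chr_add algebra_simps)
      then show ?thesis
        by (simp only: sum.distrib) (simp only: sum.swap[of _ B3 B2])
    qed
    have main: "norm (\<Sum>k\<in>B2. \<Sum>l\<in>B3. chr \<theta> k * of_real (F (n + k + l))) \<le> (\<Sum>k\<in>B2. \<bar>T (n + k)\<bar>)"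
    proof (intro sum_norm_le)
      fix k
      have "(\<Sum>l\<in>B3. chr \<theta> k * of_real (F (n + k + l))) = chr \<theta> k * of_real (T (n + k))"
        by (simp add: T_def sum_distrib_left)
      then show "norm (\<Sum>l\<in>B3. chr \<theta> k * of_real (F (n + k + l))) \<le> \<bar>T (n + k)\<bar>"
        by (simp add: norm_mult)
    qed
    have "norm (\<Sum>l\<in>B3. \<Sum>k\<in>B2. (chr \<theta> l - 1) * (chr \<theta> k * of_real (F (n + k + l))))
        \<le> (\<Sum>l\<in>B3. \<Sum>k\<in>B2. \<rho> * 1)"
    proof (intro sum_norm_le)
      fix l k assume "l \<in> B3"
      have "norm ((chr \<theta> l - 1) * (chr \<theta> k * of_real (F (n + k + l))))
          = norm (chr \<theta> l - 1) * \<bar>F (n + k + l)\<bar>" by (simp add: norm_mult)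
      also have "\<dots> \<le> \<rho> * 1"
        using \<theta>[OF \<open>l \<in> B3\<close>] F1 order_trans[OF norm_ge_zero \<theta>[OF \<open>l \<in> B3\<close>]] by (intro mult_mono) auto
      finally show "norm ((chr \<theta> l - 1) * (chr \<theta> k * of_real (F (n + k + l)))) \<le> \<rho> * 1" .
    qed
    then have "norm (\<Sum>l\<in>B3. \<Sum>k\<in>B2. (chr \<theta> l - 1) * (chr \<theta> k * of_real (F (n + k + l)))) \<le> \<rho> * b2 * b3"
      by (simp add: b_def mult_ac)
    then have "norm (\<Sum>l\<in>B3. \<Sum>k\<in>B2. ?g (k + l)) \<le> (\<Sum>k\<in>B2. \<bar>T (n + k)\<bar>) + \<rho> * b2 * b3"
      unfolding split using main by (intro norm_triangle_le add_mono)
    then show ?thesis using 1 by (simp add: distrib_right)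
  qed
  have "b3 * (\<sigma> * b1 * b2) \<le> b3 * (\<Sum>n\<in>B1. norm (\<Sum>k\<in>B2. chr \<theta> k * of_real (F (n + k))))"
    using four b by (intro mult_left_mono) (auto simp: b_def)
  also have "\<dots> \<le> (\<Sum>n\<in>B1. (\<Sum>k\<in>B2. \<bar>T (n + k)\<bar>) + (2 * \<epsilon> + \<rho>) * b2 * b3)"
    unfolding sum_distrib_left by (intro sum_mono shift)
  also have "\<dots> = (\<Sum>n\<in>B1. \<Sum>k\<in>B2. \<bar>T (n + k)\<bar>) + (2 * \<epsilon> + \<rho>) * (b1 * b2 * b3)"
    by (simp add: sum.distrib b_def)
  finally have abs: "(\<sigma> - 2 * \<epsilon> - \<rho>) * (b1 * b2 * b3) \<le> (\<Sum>n\<in>B1. \<Sum>k\<in>B2. \<bar>T (n + k)\<bar>)"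
    by (simp add: algebra_simps)
  have "(\<Sum>p\<in>B2\<times>B3. \<Sum>n\<in>B1. F (n + (fst p + snd p)))
      \<ge> card (B2 \<times> B3) * (\<Sum>n\<in>B1. F n) - 2 * \<epsilon> * b1 * card (B2 \<times> B3)"
    using sum_shifts_near_inv[OF B(1), of "B2 \<times> B3" \<epsilon> "\<lambda>p. fst p + snd p" F] inv1 F1
    by (auto simp: b_def abs_le_iff)
  moreover have "card (B2 \<times> B3) * (\<Sum>n\<in>B1. F n) \<ge> card (B2 \<times> B3) * (- (\<sigma> / 4) * b1)"
    using mean by (intro mult_left_mono) (auto simp: b_def)
  moreover have "(\<Sum>p\<in>B2\<times>B3. \<Sum>n\<in>B1. F (n + (fst p + snd p))) = (\<Sum>n\<in>B1. \<Sum>k\<in>B2. T (n + k))"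
    unfolding T_def by (subst sum.swap) (simp add: sum.cartesian_product case_prod_unfold ac_simps)
  ultimately have mean3: "(- (\<sigma> / 4) - 2 * \<epsilon>) * (b1 * b2 * b3) \<le> (\<Sum>n\<in>B1. \<Sum>k\<in>B2. T (n + k))"
    by (simp add: b_def card_cartesian_product algebra_simps)
  have "\<sigma> / 2 * b3 * card (B1 \<times> B2) = \<sigma> / 2 * (b1 * b2 * b3)"
    by (simp add: b_def card_cartesian_product)
  also have "\<dots> \<le> (\<sigma> - 2 * \<epsilon> - \<rho> + (- (\<sigma> / 4) - 2 * \<epsilon>)) * (b1 * b2 * b3)"
    using small b by (intro mult_right_mono) auto
  also have "\<dots> \<le> (\<Sum>n\<in>B1. \<Sum>k\<in>B2. \<bar>T (n + k)\<bar>) + (\<Sum>n\<in>B1. \<Sum>k\<in>B2. T (n + k))"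
    using abs mean3 by (simp add: algebra_simps)
  also have "\<dots> = (\<Sum>p\<in>B1\<times>B2. \<bar>T (fst p + snd p)\<bar> + T (fst p + snd p))"
    by (simp add: sum.cartesian_product case_prod_unfold sum.distrib)
  finally obtain p where "\<sigma> / 2 * b3 \<le> \<bar>T (fst p + snd p)\<bar> + T (fst p + snd p)"
    by (rule exists_ge_average[rotated 2]) (use B in auto)
  moreover have "\<sigma> / 2 * b3 > 0" using \<sigma> b by simp
  \<comment> \<open>A positive value of \<open>\<bar>T\<bar> + T\<close> forces
    \<open>T > 0\<close>, and then it equals \<open>2 * T\<close>.\<close>
  ultimately have "\<sigma> / 4 * b3 \<le> T (fst p + snd p)" by linarith
  then show ?thesis using that unfolding T_def b_def by blast
qed

section \<open>The density increment\<close>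

text \<open>The parameters depend on the fixed lower bound \<open>\<beta>\<close> and not on the
  current density \<open>\<alpha>\<close>, so they stay constant along the iteration. The negated
  conclusion serves twice: as an upper bound for the density on translates of \<open>B1\<close>, and
  at the end, where a gain of \<open>\<sigma> / 4 \<ge> \<tau>\<close> on \<open>B3\<close>
  contradicts it.\<close>

lemma bohr_density_increment:
  fixes \<alpha> \<beta> \<eta> \<sigma> \<tau> \<epsilon> \<rho> t :: real and s N K :: nat
  defines "\<eta> \<equiv> (\<beta> / 4) ^ (2 * s - 1)" and "\<sigma> \<equiv> \<eta> ^ 3 / 4096"
  defines "\<tau> \<equiv> \<beta> * \<eta> * \<sigma> / 128" and "\<epsilon> \<equiv> \<beta> * \<eta> * \<sigma> / 512"
  assumes noconf: "\<not> contains_nontrivial_configuration s A" and s: "s \<ge> 2"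
    and \<beta>: "0 < \<beta>" "\<beta> \<le> \<alpha>" "\<alpha> \<le> 1" and N: "N \<ge> 1"
    and K: "(1 + \<epsilon>) ^ K \<ge> 5 * N" "1 / \<epsilon> \<le> K"
    and \<Gamma>: "finite \<Gamma>" and t: "0 < t" "t \<le> 1" and \<rho>: "0 \<le> \<rho>" and reg: "bohr_reg \<epsilon> N \<Gamma> \<rho> t"
    and dens: "\<alpha> * card (bohr N \<Gamma> \<rho>) \<le> (\<Sum>x\<in>bohr N \<Gamma> \<rho>. of_bool (x0 + x \<in> A))"
    and large: "1 \<le> (\<beta> / 4) ^ s * card (bohr N \<Gamma> (t / 4))"
  shows "\<exists>\<Gamma>' \<rho>' x'. finite \<Gamma>' \<and> card \<Gamma>' \<le> card \<Gamma> + 1 \<and> 0 \<le> \<rho>' \<and>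
    bohr_reg \<epsilon> N \<Gamma>' \<rho>' (t / (32 * K ^ 3)) \<and>
    (\<alpha> + \<tau>) * card (bohr N \<Gamma>' \<rho>') \<le> (\<Sum>x\<in>bohr N \<Gamma>' \<rho>'. of_bool (x' + x \<in> A))"
proof (rule ccontr)
  assume neg: "\<not> ?thesis"
  have noinc: "(\<Sum>x\<in>bohr N \<Gamma>' \<rho>'. of_bool (x' + x \<in> A)) \<le> (\<alpha> + \<tau>) * card (bohr N \<Gamma>' \<rho>')"
    if "finite \<Gamma>'" "card \<Gamma>' \<le> card \<Gamma> + 1" "0 \<le> \<rho>'" "bohr_reg \<epsilon> N \<Gamma>' \<rho>' (t / (32 * K ^ 3))" for \<Gamma>' \<rho>' x'
    using neg that by (meson less_imp_le not_le)
  have \<beta>1: "\<beta> \<le> 1" and \<alpha>: "0 < \<alpha>" using \<beta> by linarith+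
  have \<eta>: "0 < \<eta>" "\<eta> \<le> 1" unfolding \<eta>_def using \<beta> by (auto intro: power_le_one)
  have \<sigma>: "0 < \<sigma>" using \<eta> by (simp add: \<sigma>_def)
  have "\<eta> ^ 3 \<le> 1" using \<eta> by (simp add: power_le_one)
  then have \<sigma>1: "\<sigma> \<le> 1" by (simp add: \<sigma>_def)
  have \<eta>\<sigma>: "\<eta> * \<sigma> \<le> \<sigma>" "\<eta> * \<sigma> \<le> \<eta>" "\<eta> * \<sigma> \<le> 1" "0 < \<eta> * \<sigma>"
    using \<eta> \<sigma> \<sigma>1 mult_mono[of \<eta> 1 \<sigma> 1] by (auto simp: mult_left_le mult_left_le_one_le)
  have \<beta>\<eta>\<sigma>: "\<beta> * \<eta> * \<sigma> \<le> \<eta> * \<sigma>" "\<beta> * \<eta> * \<sigma> \<le> \<beta>" "0 < \<beta> * \<eta> * \<sigma>"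
    using \<beta>(1) \<beta>1 \<eta>\<sigma> mult_right_mono[of \<beta> 1 "\<eta> * \<sigma>"] mult_left_mono[of "\<eta> * \<sigma>" 1 \<beta>]
    by (auto simp: mult.assoc)
  have \<epsilon>: "0 < \<epsilon>" "\<epsilon> \<le> \<sigma> / 512" "\<epsilon> \<le> \<eta> / 512" "\<epsilon> \<le> 1"
    using \<beta>\<eta>\<sigma> \<eta>\<sigma> \<sigma>1 \<eta> unfolding \<epsilon>_def by linarith+
  have \<tau>: "0 < \<tau>" "\<tau> \<le> \<sigma> / 4" using \<beta>\<eta>\<sigma> \<eta>\<sigma> \<sigma> unfolding \<tau>_def by linarith+
  \<comment> \<open>The weights for choosing the base point and for localising. They satisfy
    \<open>W' / W = \<eta> / 8\<close>, and \<open>1 / W' = \<sigma> / 4\<close> is the deficit in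
    the mean that the last step tolerates; \<open>\<tau>\<close> is small enough against
    both.\<close>
  define W W' where "W = 32 / (\<eta> * \<sigma>)" and "W' = 4 / \<sigma>"
  have W: "0 < W" "0 < W'" using \<eta> \<sigma> by (auto simp: W_def W'_def)
  have "K \<noteq> 0" using K(1) N by (intro notI) simp
  then have K1: "K \<ge> 1" by simp
  have "1 / \<epsilon> > 0" using \<epsilon> by simp
  then have Ke: "1 / real K \<le> \<epsilon>" using K(2) \<epsilon>(1) K1 by (simp add: field_simps)
  \<comment> \<open>Widths of regularity of \<open>B1\<close>, \<open>B2\<close>, \<open>B3\<close>,
    whose radii are at most \<open>t / 2\<close>, \<open>t1 / 2\<close> and \<open>t2\<close>. The
    halvings keep sums of two elements of \<open>B1\<close> within the width \<open>t\<close> of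
    \<open>B0\<close>, and sums from \<open>B2\<close> and \<open>B3\<close> within the width
    \<open>t1\<close> of \<open>B1\<close>.\<close>
  define t1 t2 t3 where "t1 = t / 2 / (2 * K)" and "t2 = t1 / 2 / (2 * K)" and "t3 = t2 / (2 * K)"
  have t12: "0 < t1" "0 < t2" "0 < t3" using t K1 by (auto simp: t1_def t2_def t3_def)
  have t1le: "t1 \<le> t / 4" "t1 \<le> 1 / K" using t K1 by (auto simp: t1_def field_simps)
  have t2le: "t2 \<le> t1 / 4" using t12 K1 by (simp add: t2_def field_simps)
  have t3le: "t3 \<le> t2 / 2" using t12 K1 by (simp add: t3_def field_simps)
  have t3_eq: "t3 = t / (32 * K ^ 3)"
    by (simp add: t1_def t2_def t3_def power3_eq_cube)
  have t3t1: "t3 \<le> t1" using t12 t2le t3le by linarith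
  have \<epsilon>0: "0 \<le> \<epsilon>" using \<epsilon> by simp

  obtain \<rho>1 where \<rho>1: "t / 2 / 2 \<le> \<rho>1" "\<rho>1 \<le> t / 2" "bohr_reg \<epsilon> N \<Gamma> \<rho>1 t1"
    using exists_bohr_reg[of "t/2" N \<epsilon> K \<Gamma>] t N K(1) K1 \<epsilon>0 unfolding t1_def by auto
  obtain \<rho>2 where \<rho>2: "t1 / 2 / 2 \<le> \<rho>2" "\<rho>2 \<le> t1 / 2" "bohr_reg \<epsilon> N \<Gamma> \<rho>2 t2"
    using exists_bohr_reg[of "t1/2" N \<epsilon> K \<Gamma>] t1le t12 t N K(1) K1 \<epsilon>0 unfolding t2_def by auto
  have \<rho>12: "0 \<le> \<rho>1" "0 \<le> \<rho>2" using \<rho>1 \<rho>2 t t12 by linarith+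
  let ?B0 = "bohr N \<Gamma> \<rho>" and ?B1 = "bohr N \<Gamma> \<rho>1" and ?B2 = "bohr N \<Gamma> \<rho>2"
  let ?f = "\<lambda>x. of_bool (x \<in> A) - \<alpha>"
  have f1: "\<bar>of_bool P - \<alpha>\<bar> \<le> 1" for P using \<beta> by (cases P) auto
  have ne: "?B0 \<noteq> {}" "?B1 \<noteq> {}" "?B2 \<noteq> {}" using zero_in_bohr \<rho> \<rho>12 by blast+
  define b1 where "b1 = real (card ?B1)"
  have b1: "b1 > 0" using card_bohr_pos[OF \<rho>12(1)] by (simp add: b1_def)
  \<comment> \<open>\<open>B1\<close> has the frequencies of \<open>B0\<close> and is regular at the
    larger width \<open>t1\<close>, so it is among the Bohr sets assumed to carry no
    increment.\<close>
  have noinc1: "(\<Sum>n\<in>?B1. ?f (x + n)) \<le> \<tau> * card ?B1" for x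
    using noinc[OF \<Gamma> _ \<rho>12(1) bohr_reg_mono[OF \<rho>1(3) t3t1[unfolded t3_eq]], of x]
    by (simp add: sum_subtractf algebra_simps)
  have inv0: "near_inv \<epsilon> ?B0 (c + n)" if "c \<in> ?B1" "n \<in> ?B1" for c n
    using bohr_add[OF that] bohr_mono[of "\<rho>1 + \<rho>1" t N \<Gamma>] \<rho>1(2) t(1)
    by (intro near_inv_bohr[OF reg]) auto
  have W\<tau>: "W * \<tau> \<le> \<alpha> / 4"
    using \<eta> \<sigma> \<beta> by (simp add: W_def \<tau>_def)
  have "W * \<epsilon> = \<beta> / 16" using \<eta> \<sigma> by (simp add: W_def \<epsilon>_def)
  moreover have "\<epsilon> \<le> \<beta> / 512" using \<beta>\<eta>\<sigma>(2) unfolding \<epsilon>_def by simp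
  moreover have "2 * \<epsilon> * (1 + W) = 2 * \<epsilon> + 2 * (W * \<epsilon>)" by (simp add: algebra_simps)
  ultimately have W\<epsilon>: "2 * \<epsilon> * (1 + W) \<le> \<alpha> / 4" using \<beta> by linarith
  obtain Y where Y: "\<alpha> / 2 * card ?B1 \<le> card {n\<in>?B1. n + n + Y \<in> A}"
    "- ((real (card ?B1))\<^sup>2 / W) \<le> (\<Sum>c\<in>?B1. \<Sum>n\<in>?B1. ?f (Y + c + n))"
  proof (rule choose_base_point[OF finite_bohr ne(1) finite_bohr ne(2) \<alpha> \<beta>(3) W(1) W\<tau> W\<epsilon> inv0])
    show "0 \<le> (\<Sum>x\<in>?B0. ?f (x0 + x))"
      using dens by (simp add: sum_subtractf mult.commute)
  qed (use noinc1 in auto)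

  define q where "q = (\<beta> / 4) ^ (s - 1) * b1"
  have "card (bohr N \<Gamma> (t / 4)) \<le> card ?B1"
    using \<rho>1(1) by (intro card_mono bohr_mono) auto
  then have "(\<beta> / 4) ^ s * card (bohr N \<Gamma> (t / 4)) \<le> (\<beta> / 4) ^ s * b1"
    using \<beta> by (intro mult_left_mono) (auto simp: b1_def)
  then have "1 \<le> (\<beta> / 4) ^ s * b1" using large by linarith
  also have "\<dots> = \<beta> / 4 * q" using s by (cases s) (auto simp: q_def)
  also have "\<dots> \<le> \<alpha> / 4 * q" using \<beta> b1 by (intro mult_right_mono) (auto simp: q_def)
  finally have q1: "1 \<le> \<alpha> / 4 * q" .
  have q2: "q \<le> (\<alpha> / 4) ^ (s - 1) * card ?B1"
    unfolding q_def b1_def using \<beta> by (intro mult_right_mono power_mono) auto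
  obtain V where V: "V \<subseteq> ?B1" "q \<le> card V"
    "(\<Sum>n\<in>V. \<Sum>m\<in>V. of_bool (n + m + Y \<in> A)) < \<alpha> / 2 * (real (card V))\<^sup>2"
    using no_configuration_imp_sparse_subset[OF noconf s finite_bohr \<alpha> \<beta>(3) q1 q2 Y(1)] by blast
  \<comment> \<open>The exponent \<open>2 * s - 1\<close> in \<open>\<eta>\<close> arises here:
    \<open>2 * (s - 1)\<close> from the square of \<open>card V\<close>, and one more from the
    density factor.\<close>
  have "\<eta> * b1\<^sup>2 = \<beta> / 4 * q\<^sup>2"
  proof -
    have "2 * s - 1 = Suc ((s - 1) * 2)" using s by simp
    then show ?thesis by (simp add: \<eta>_def q_def power_mult_distrib power_mult)
  qed
  also have "\<dots> \<le> \<alpha> / 2 * (real (card V))\<^sup>2"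
    using \<beta> \<alpha> V(2) b1 by (intro mult_mono power_mono) (auto simp: q_def)
  finally have "- \<alpha> / 2 * (real (card V))\<^sup>2 \<le> - \<eta> * b1\<^sup>2" by simp
  moreover have "(\<Sum>n\<in>V. \<Sum>m\<in>V. ?f (n + m + Y))
      = (\<Sum>n\<in>V. \<Sum>m\<in>V. of_bool (n + m + Y \<in> A)) - \<alpha> * (real (card V))\<^sup>2"
    by (simp add: sum_subtractf power2_eq_square)
  ultimately have bias: "(\<Sum>n\<in>V. \<Sum>m\<in>V. ?f (n + m + Y)) \<le> - \<eta> * (real (card ?B1))\<^sup>2"
    using V(3) unfolding b1_def by linarith

  have inv1: "near_inv \<epsilon> ?B1 k" if "k \<in> bohr N \<Gamma> r" "r \<le> t1" for k r
    using that bohr_mono[of r t1 N \<Gamma>] t12 by (intro near_inv_bohr[OF \<rho>1(3)]) auto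
  have \<rho>2t1: "\<rho>2 \<le> t1" using \<rho>2 t12 by linarith
  obtain c where c:
    "(\<Sum>n\<in>V. \<Sum>k\<in>?B2. of_bool (c + k \<in> V) * ?f (Y + c + (n + k))) \<le> - (\<eta> / 2) * card ?B1 * card ?B2"
    "- (card ?B1 / W') \<le> (\<Sum>n\<in>?B1. ?f (Y + c + n))"
  proof (rule localise_bias[where f = ?f and ?B1.0 = ?B1 and ?B2.0 = ?B2 and V = V and \<eta> = \<eta> and W = W
        and W' = W' and \<tau> = \<tau> and \<epsilon> = \<epsilon> and Y = Y])
    show "W' / W \<le> \<eta> / 8" using \<eta> \<sigma> by (simp add: W_def W'_def)
    have "W' * \<tau> = \<beta> * \<eta> / 32" using \<sigma> by (simp add: W'_def \<tau>_def)
    also have "\<dots> \<le> \<eta> / 4" using \<beta>1 \<beta>(1) \<eta>(1) mult_right_mono[of \<beta> 1 \<eta>] by simp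
    finally show "W' * \<tau> \<le> \<eta> / 4" .
    show "2 * \<epsilon> \<le> \<eta> / 8" using \<epsilon>(3) \<eta> by simp
    show "near_inv \<epsilon> ?B1 k" if "k \<in> ?B2" for k using inv1[OF that \<rho>2t1] .
  qed (use ne V(1) f1 \<eta> W noinc1 Y(2) bias in auto)

  define F where "F x = ?f (Y + c + x)" for x
  have F1: "\<bar>F x\<bar> \<le> 1" for x unfolding F_def by (rule f1)
  let ?S = "bohr N \<Gamma> (\<rho>1 + \<rho>2)"
  have "card ?S \<le> card (bohr N \<Gamma> (\<rho>1 + t1))"
    using \<rho>2t1 by (intro card_mono bohr_mono) auto
  then have "real (card ?S) \<le> real (card (bohr N \<Gamma> (\<rho>1 + t1)))" by simp
  also have "\<dots> \<le> (1 + \<epsilon>) * b1" using \<rho>1(3) by (simp add: bohr_reg_def b1_def)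
  also have "\<dots> \<le> 2 * b1" using \<epsilon>(4) b1 by (intro mult_right_mono) auto
  finally have S: "card ?S \<le> 2 * card ?B1" by (simp add: b1_def)
  obtain \<theta> where \<theta>: "\<sigma> * card ?B1 * card ?B2
      \<le> (\<Sum>n\<in>?B1. norm (\<Sum>k\<in>?B2. chr \<theta> k * of_real (F (n + k))))"
  proof (rule bias_imp_local_fourier_coefficient[where ?B1.0 = ?B1 and ?B2.0 = ?B2 and S = ?S and V = V
        and F = F and \<eta> = \<eta> and v = "\<lambda>k. of_bool (c + k \<in> V)"])
    have "\<eta> / 2 * card ?B1 * card ?B2 \<ge> 0" using \<eta> by simp
    then show "\<eta> / 2 * card ?B1 * card ?B2
        \<le> \<bar>\<Sum>n\<in>V. \<Sum>k\<in>?B2. of_bool (c + k \<in> V) * F (n + k)\<bar>"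
      using c(1) unfolding F_def by linarith
  qed (use V(1) F1 \<eta> S ne bohr_add in \<open>auto simp: \<sigma>_def\<close>)

  let ?\<Delta> = "insert \<theta> \<Gamma>"
  have \<Delta>: "finite ?\<Delta>" "card ?\<Delta> \<le> card \<Gamma> + 1" using \<Gamma> by (auto simp: card_insert_if)
  obtain \<rho>3 where \<rho>3: "t2 / 2 \<le> \<rho>3" "\<rho>3 \<le> t2" "bohr_reg \<epsilon> N ?\<Delta> \<rho>3 t3"
    using exists_bohr_reg[of t2 N \<epsilon> K ?\<Delta>] t2le t1le t12 t N K(1) K1 \<epsilon>0 unfolding t3_def by auto
  have \<rho>30: "0 \<le> \<rho>3" using \<rho>3 t12 by linarith
  let ?B3 = "bohr N ?\<Delta> \<rho>3"
  have B3: "?B3 \<subseteq> bohr N \<Gamma> \<rho>3" by (rule bohr_antimono) auto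
  obtain x where x: "\<sigma> / 4 * card ?B3 \<le> (\<Sum>l\<in>?B3. F (x + l))"
  proof (rule local_fourier_coefficient_imp_increment[where ?B1.0 = ?B1 and ?B2.0 = ?B2 and ?B3.0 = ?B3
        and F = F and \<theta> = \<theta> and \<epsilon> = \<epsilon> and \<sigma> = \<sigma> and \<rho> = "2 * pi * \<rho>3"])
    show "?B3 \<noteq> {}" using zero_in_bohr \<rho>30 by blast
    show "near_inv \<epsilon> ?B1 (k + l)" if "k \<in> ?B2" "l \<in> ?B3" for k l
      using that bohr_add[of k N \<Gamma> \<rho>2 l \<rho>3] B3 \<rho>2 \<rho>3 t2le t12 by (intro inv1[of _ "\<rho>2 + \<rho>3"]) auto
    show "near_inv \<epsilon> ?B2 l" if "l \<in> ?B3" for l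
      using that B3 bohr_mono[OF \<rho>3(2), of N \<Gamma>] t12 by (intro near_inv_bohr[OF \<rho>2(3)]) auto
    show "norm (chr \<theta> l - 1) \<le> 2 * pi * \<rho>3" if "l \<in> ?B3" for l
      using that norm_chr_minus_one_le unfolding bohr_def by auto
    have "2 * pi * \<rho>3 \<le> 2 * 4 * \<epsilon>"
    proof (intro mult_mono)
      show "\<rho>3 \<le> \<epsilon>" using \<rho>3(2) t2le t1le(2) Ke t12 by linarith
    qed (use \<rho>30 pi_less_4 in auto)
    then show "4 * \<epsilon> + 2 * pi * \<rho>3 \<le> \<sigma> / 4" using \<epsilon>(2) \<sigma> by linarith
    show "- (\<sigma> / 4) * card ?B1 \<le> (\<Sum>n\<in>?B1. F n)"
      using c(2) unfolding F_def W'_def by (simp add: mult.commute)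
  qed (use ne F1 \<theta> \<sigma> in auto)
  have *: "(\<Sum>l\<in>?B3. F (x + l)) = (\<Sum>l\<in>?B3. of_bool (Y + c + x + l \<in> A)) - \<alpha> * card ?B3"
    by (simp add: F_def sum_subtractf add.assoc)
  have "(\<alpha> + \<tau>) * card ?B3 \<le> (\<alpha> + \<sigma> / 4) * card ?B3"
    using \<tau>(2) by (intro mult_right_mono) auto
  also have "\<dots> \<le> (\<Sum>l\<in>?B3. of_bool (Y + c + x + l \<in> A))"
    using x * by (simp add: algebra_simps)
  finally show False using neg \<Delta> \<rho>30 \<rho>3(3) t3_eq by blast
qed

section \<open>Iteration of the increment\<close>

text \<open>Each step raises the density by \<open>\<tau>\<close>, so after \<open>T\<close> steps
  it would exceed 1. The factor 5 pays for the start, where the Bohr set may have up to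
  \<open>5 * N\<close> elements. Assumption \<open>large\<close> concerns the final radius; the
  larger radii of earlier steps inherit it.\<close>

lemma configuration_of_density_iteration:
  fixes \<beta> \<eta> \<sigma> \<tau> \<epsilon> :: real and s N K T :: nat
  defines "\<eta> \<equiv> (\<beta> / 4) ^ (2 * s - 1)" and "\<sigma> \<equiv> \<eta> ^ 3 / 4096"
  defines "\<tau> \<equiv> \<beta> * \<eta> * \<sigma> / 128" and "\<epsilon> \<equiv> \<beta> * \<eta> * \<sigma> / 512"
  assumes s: "s \<ge> 2" and \<beta>: "0 < \<beta>" and N: "N \<ge> 1"
    and K: "(1 + \<epsilon>) ^ K \<ge> 5 * N" "1 / \<epsilon> \<le> K"
    and A: "A \<subseteq> {1..int N}" "5 * \<beta> * N \<le> card A"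
    and T: "1 < \<beta> + T * \<tau>"
    and large: "\<And>\<Gamma>. finite \<Gamma> \<Longrightarrow> card \<Gamma> \<le> T \<Longrightarrow>
      1 \<le> (\<beta> / 4) ^ s * card (bohr N \<Gamma> (1 / real (4 * K * (32 * K ^ 3) ^ T)))"
  shows "contains_nontrivial_configuration s A"
proof (rule ccontr)
  assume noconf: "\<not> ?thesis"
  have "\<eta> > 0" using \<beta> by (simp add: \<eta>_def)
  then have \<tau>0: "0 < \<tau>" and \<epsilon>0: "0 < \<epsilon>" using \<beta> by (auto simp: \<tau>_def \<epsilon>_def \<sigma>_def)
  have "K \<noteq> 0" using K(1) N by (intro notI) simp
  then have K1: "K \<ge> 1" by simp
  have finA: "finite A" using A(1) finite_atLeastAtMost_int by (rule finite_subset)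
  have le1: "(\<Sum>x\<in>bohr N \<Gamma> \<rho>. of_bool (x0 + x \<in> A)) \<le> real (card (bohr N \<Gamma> \<rho>))" for \<Gamma> \<rho> x0
    using sum_bounded_above[of "bohr N \<Gamma> \<rho>" "\<lambda>x. of_bool (x0 + x \<in> A)" "1::real"] by simp
  have le_one: "\<gamma> \<le> 1"
    if "0 \<le> \<rho>" "\<gamma> * card (bohr N \<Gamma> \<rho>) \<le> (\<Sum>x\<in>bohr N \<Gamma> \<rho>. of_bool (x0 + x \<in> A))" for \<gamma> \<rho> :: real and \<Gamma> x0
  proof -
    have "\<gamma> * card (bohr N \<Gamma> \<rho>) \<le> 1 * real (card (bohr N \<Gamma> \<rho>))"
      using that(2) le1[where \<Gamma> = \<Gamma> and \<rho> = \<rho> and ?x0.0 = x0] by linarith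
    then show ?thesis using card_bohr_pos[OF that(1), of N \<Gamma>] by (simp add: mult_le_cancel_right)
  qed
  have iter: "\<exists>\<Gamma> \<rho> x0. finite \<Gamma> \<and> card \<Gamma> \<le> j \<and> 0 \<le> \<rho> \<and>
      bohr_reg \<epsilon> N \<Gamma> \<rho> (1 / real (K * (32 * K ^ 3) ^ j)) \<and>
      (\<beta> + j * \<tau>) * card (bohr N \<Gamma> \<rho>) \<le> (\<Sum>x\<in>bohr N \<Gamma> \<rho>. of_bool (x0 + x \<in> A))"
    if "j \<le> T" for j
    using that
  proof (induction j)
    case 0
    \<comment> \<open>Without frequencies and with radius at least 1, the Bohr set is an interval
      containing \<open>A\<close>. Taking \<open>r = 2\<close> turns the width
      \<open>r / (2 * K)\<close> into the \<open>1 / K\<close> needed for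
      \<open>j = 0\<close>.\<close>
    obtain \<rho> where \<rho>: "1 \<le> \<rho>" "\<rho> \<le> 2" "bohr_reg \<epsilon> N {} \<rho> (1 / K)"
      using exists_bohr_reg[of 2 N \<epsilon> K "{}"] N K(1) K1 \<epsilon>0 by auto
    have "A \<subseteq> bohr N {} \<rho>"
    proof
      fix x assume "x \<in> A"
      then have "\<bar>real_of_int x\<bar> \<le> 1 * real N" using A(1) by auto
      also have "\<dots> \<le> \<rho> * N" using \<rho>(1) by (intro mult_right_mono) auto
      finally show "x \<in> bohr N {} \<rho>" by (simp add: bohr_def)
    qed
    then have "(\<Sum>x\<in>bohr N {} \<rho>. of_bool (0 + x \<in> A)) = real (card A)"
      using finA by (simp add: Int_absorb1)
    moreover have "\<beta> * card (bohr N {} \<rho>) \<le> \<beta> * (5 * N)"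
      using \<rho> N \<beta> by (intro mult_left_mono card_bohr_le) auto
    ultimately have "(\<beta> + real 0 * \<tau>) * card (bohr N {} \<rho>) \<le> (\<Sum>x\<in>bohr N {} \<rho>. of_bool (0 + x \<in> A))"
      using A(2) by simp
    then show ?case using \<rho>
      by (intro exI[of _ "{}"] exI[of _ \<rho>] exI[of _ 0]) auto
  next
    case (Suc j)
    then obtain \<Gamma> \<rho> x0 where *: "finite \<Gamma>" "card \<Gamma> \<le> j" "0 \<le> \<rho>"
      "bohr_reg \<epsilon> N \<Gamma> \<rho> (1 / real (K * (32 * K ^ 3) ^ j))"
      "(\<beta> + j * \<tau>) * card (bohr N \<Gamma> \<rho>) \<le> (\<Sum>x\<in>bohr N \<Gamma> \<rho>. of_bool (x0 + x \<in> A))"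
      by auto
    define M where "M = K * (32 * K ^ 3) ^ j"
    have M: "M \<ge> 1" using K1 by (simp add: M_def)
    \<comment> \<open>Comparison of the radius at step \<open>j\<close> with the final one; the
      factor 4 matches the \<open>t / 4\<close> in the size condition of the increment step.\<close>
    have "(32 * K ^ 3) ^ j \<le> (32 * K ^ 3) ^ T"
      using Suc.prems K1 by (intro power_increasing) auto
    then have "4 * M \<le> 4 * K * (32 * K ^ 3) ^ T" by (simp add: M_def mult_le_mono)
    then have "1 / real (4 * K * (32 * K ^ 3) ^ T) \<le> 1 / real (4 * M)"
      using M K1 by (intro divide_left_mono) (auto intro!: mult_pos_pos simp del: of_nat_mult)
    then have "card (bohr N \<Gamma> (1 / real (4 * K * (32 * K ^ 3) ^ T))) \<le> card (bohr N \<Gamma> (1 / M / 4))"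
      by (intro card_mono bohr_mono) (auto simp: mult.commute)
    then have "(\<beta> / 4) ^ s * card (bohr N \<Gamma> (1 / real (4 * K * (32 * K ^ 3) ^ T)))
        \<le> (\<beta> / 4) ^ s * card (bohr N \<Gamma> (1 / M / 4))"
      using \<beta> by (intro mult_left_mono) auto
    then have big: "1 \<le> (\<beta> / 4) ^ s * card (bohr N \<Gamma> (1 / M / 4))"
      using large[of \<Gamma>] *(1,2) Suc.prems by linarith
    have \<beta>\<alpha>: "\<beta> \<le> \<beta> + j * \<tau>" using \<tau>0 by simp
    have t: "0 < 1 / real M" "1 / real M \<le> 1" "bohr_reg \<epsilon> N \<Gamma> \<rho> (1 / M)"
      using M *(4) unfolding M_def [symmetric] by auto
    obtain \<Gamma>' \<rho>' x' where **: "finite \<Gamma>'" "card \<Gamma>' \<le> card \<Gamma> + 1" "0 \<le> \<rho>'"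
      "bohr_reg \<epsilon> N \<Gamma>' \<rho>' (1 / M / (32 * K ^ 3))"
      "(\<beta> + j * \<tau> + \<tau>) * card (bohr N \<Gamma>' \<rho>') \<le> (\<Sum>x\<in>bohr N \<Gamma>' \<rho>'. of_bool (x' + x \<in> A))"
      using bohr_density_increment[OF noconf s \<beta> \<beta>\<alpha> le_one[OF *(3,5)] N, folded \<eta>_def, folded \<sigma>_def,
          folded \<tau>_def \<epsilon>_def, OF K *(1) t(1,2) *(3) t(3) *(5) big]
      by blast
    have "1 / M / (32 * K ^ 3) = 1 / real (K * (32 * K ^ 3) ^ Suc j)"
      by (simp add: M_def)
    then show ?case using ** *(2)
      by (intro exI[of _ \<Gamma>'] exI[of _ \<rho>'] exI[of _ x']) (auto simp: algebra_simps)
  qed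
  from iter[OF order_refl] le_one T show False by fastforce
qed

section \<open>Choice of parameters and numerical estimates\<close>

text \<open>Gives \<open>ln 3 \<ge> 51 / 50\<close>, so that \<open>ln (ln N)\<close> is positive
  and \<open>L - 1\<close> stays away from 0 already for \<open>N = 3\<close>. Taking an eighth root
  brings the argument into the range of \<open>exp_bound\<close>.\<close>

lemma exp_51_50_le: "exp (51 / 50) \<le> (3::real)"
proof -
  have "exp (51 / 50) = exp (51 / 400 :: real) ^ 8"
    by (simp add: exp_of_nat_mult [symmetric])
  also have "\<dots> \<le> (1 + 51 / 400 + (51 / 400)\<^sup>2) ^ 8"
    by (intro power_mono exp_bound) auto
  also have "\<dots> \<le> 3" by (simp add: power_divide field_simps)
  finally show ?thesis .
qed

theorem theorem1p2:
  fixes s N :: nat and A :: "int set" and \<delta> :: real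
  assumes "s \<ge> 2" and "N \<ge> 3"
    and "A \<subseteq> {1..int N}"
    and "real (card A) = \<delta> * real N"
    and "\<delta> \<ge> 100 * (ln (ln (real N)) / ln (real N)) powr (1 / (6 * real s * (real s + 1)))"
  shows "contains_nontrivial_configuration s A"
proof -
  define L where "L = ln (real N)"
  have NL: "real N = exp L" using assms(2) by (simp add: L_def)
  have "ln (exp (51 / 50)) \<le> ln (real N)"
    using exp_51_50_le assms(2) by (subst ln_le_cancel_iff) auto
  then have L1: "51 / 50 \<le> L" by (simp add: L_def)
  then have lnL: "ln L > 0" by simp
  \<comment> \<open>The hypothesis on \<open>\<delta>\<close> bounds \<open>z\<close> by
    \<open>(\<delta> / 100) ^ e\<close>; below it is used in the form
    \<open>P * ln L \<le> L\<close>.\<close>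
  define z where "z = ln L / L"
  have z: "z > 0" using lnL L1 by (simp add: z_def)
  define e where "e = 6 * s * (s + 1)"
  have e: "e > 0" "real e = 6 * real s * (real s + 1)" using assms(1) by (auto simp: e_def algebra_simps)
  have \<delta>z: "z powr (1 / e) \<le> \<delta> / 100"
    using assms(5) by (simp add: z_def L_def e(2))
  moreover have "z powr (1 / e) > 0" using z by simp
  ultimately have \<delta>0: "\<delta> > 0" by linarith
  have "card A \<le> card {1..int N}" using assms(3) by (intro card_mono) auto
  then have "\<delta> * N \<le> 1 * real N" using assms(4) by simp
  then have \<delta>1: "\<delta> \<le> 1" using assms(2) by (simp add: mult_le_cancel_right)
  \<comment> \<open>\<open>1 / D\<close> is \<open>\<beta> / 4\<close> for the later
    \<open>\<beta> = \<delta> / 5\<close>. As \<open>8 * s - 3\<close> is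
    \<open>1 + 4 * (2 * s - 1)\<close>, the number \<open>X\<close> below is the reciprocal of
    \<open>\<beta> / 4 * \<eta> ^ 4\<close>, the order of magnitude of \<open>1 / \<tau>\<close> and
    \<open>1 / \<epsilon>\<close>.\<close>
  define D where "D = 20 / \<delta>"
  have D: "D \<ge> 20" using \<delta>0 \<delta>1 by (simp add: D_def field_simps)
  define X where "X = D ^ (8 * s - 3)"
  have X1: "X \<ge> 1" using D by (simp add: X_def)
  define P where "P = (100 / \<delta>) ^ e"
  have "z = (z powr (1 / e)) powr e" using z e(1) by (simp add: powr_powr)
  also have "\<dots> \<le> (\<delta> / 100) powr e" using \<delta>z by (intro powr_mono2) auto
  also have "\<dots> = (\<delta> / 100) ^ e" using \<delta>0 by (simp add: powr_realpow)
  also have "\<dots> = 1 / P" using \<delta>0 by (simp add: P_def power_divide)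
  finally have zP: "z \<le> 1 / P" .
  have P0: "P > 0" using \<delta>0 by (simp add: P_def)
  have PL: "P * ln L \<le> L" using zP P0 L1 by (simp add: z_def field_simps)
  \<comment> \<open>\<open>P\<close> is \<open>(5 * D) ^ e\<close>, and \<open>X\<^sup>2\<close> is
    \<open>D\<close> to the power \<open>16 * s - 6\<close>. Since
    \<open>e \<ge> 16 * s + 4 \<ge> 36\<close>, the powers of \<open>D\<close> cover
    \<open>X\<^sup>2\<close> and those of 5 cover \<open>2 ^ 72\<close>.\<close>
  have PX: "2 ^ 72 * X\<^sup>2 \<le> P"
  proof -
    have "(s - 2) * (6 * s + 2) + 16 * s + 4 = e"
    proof -
      obtain k where "s = k + 2" using assms(1) by (metis add.commute le_Suc_ex)
      then show ?thesis by (simp add: e_def algebra_simps)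
    qed
    then have se: "16 * s + 4 \<le> e" by linarith
    have "(2::real) ^ 72 = 4 ^ 36" by simp
    also have "\<dots> \<le> 5 ^ 36" by (intro power_mono) auto
    also have "\<dots> \<le> 5 ^ e" using se assms(1) by (intro power_increasing) auto
    finally have "(2::real) ^ 72 \<le> 5 ^ e" .
    moreover have "X\<^sup>2 \<le> D ^ e"
      unfolding X_def power_mult [symmetric] using se D by (intro power_increasing) auto
    ultimately have "2 ^ 72 * X\<^sup>2 \<le> 5 ^ e * D ^ e" by (intro mult_mono) auto
    also have "\<dots> = P" by (simp add: P_def D_def power_mult_distrib [symmetric])
    finally show ?thesis .
  qed
  have X2: "X \<le> X\<^sup>2" "1 \<le> X\<^sup>2" 
    using X1 mult_left_mono[OF X1, of X] by (auto simp: power2_eq_square intro: order_trans)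
  \<comment> \<open>This crude bound suffices to rule out small \<open>L\<close>: \<open>P\<close>
    is at least \<open>2 ^ 72\<close>, whereas \<open>L \<le> 100\<close> would give
    \<open>P / 50 \<le> 10000\<close>.\<close>
  have "1 - 1 / L \<le> ln L" 
    using ln_le_minus_one[of "1 / L"] L1 by (simp add: ln_div)
  then have "P * (1 - 1 / L) \<le> L" using PL P0 mult_left_mono[of "1 - 1 / L" "ln L" P] by linarith
  then have PL2: "P * (L - 1) \<le> L * L" using L1 by (simp add: field_simps)
  have L100: "L > 100"
  proof (rule ccontr)
    assume "\<not> ?thesis"
    then have "L * L \<le> 100 * 100" using L1 by (intro mult_mono) auto
    moreover have "2 ^ 72 * (1 / 50) \<le> P * (L - 1)"
      using PX X2(2) L1 by (intro mult_mono) auto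
    ultimately show False using PL2 by simp
  qed
  have "ln (exp 1) \<le> ln L" using L100 exp_le by (subst ln_le_cancel_iff) auto
  then have lnL1: "ln L \<ge> 1" by simp
  \<comment> \<open>\<open>T\<close> will be of order \<open>X\<close>, and the loss in the size of
    the Bohr sets is \<open>exp\<close> of a multiple of \<open>T\<^sup>2 * ln L\<close>, which must
    stay below \<open>L\<close>. This is where the iterated logarithm enters.\<close>
  have LX: "2 ^ 72 * X\<^sup>2 * ln L \<le> L"
    using mult_right_mono[OF PX, of "ln L"] PL lnL by linarith
  have LX': "2 ^ 72 * X\<^sup>2 \<le> L"
  proof -
    have "2 ^ 72 * X\<^sup>2 * 1 \<le> 2 ^ 72 * X\<^sup>2 * ln L" by (intro mult_left_mono lnL1) auto
    then show ?thesis using LX by linarith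
  qed

  define \<beta> where "\<beta> = \<delta> / 5"
  define \<eta> where "\<eta> = (\<beta> / 4) ^ (2 * s - 1)"
  define \<sigma> where "\<sigma> = \<eta> ^ 3 / 4096"
  define \<tau> where "\<tau> = \<beta> * \<eta> * \<sigma> / 128"
  define \<epsilon> where "\<epsilon> = \<beta> * \<eta> * \<sigma> / 512"
  have \<beta>D: "\<beta> / 4 = 1 / D" "\<beta> > 0" using \<delta>0 by (auto simp: \<beta>_def D_def)
  have "\<beta> * \<eta> * \<sigma> = (\<beta> / 4) * \<eta> ^ 4 / 1024" by (simp add: \<sigma>_def power4_eq_xxxx power3_eq_cube)
  also have "(\<beta> / 4) * \<eta> ^ 4 = 1 / X"
  proof -
    have "8 * s - 3 = Suc ((2 * s - 1) * 4)" using assms(1) by simp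
    then show ?thesis
      by (simp add: X_def \<eta>_def \<beta>D(1) power_one_over power_mult)
  qed
  finally have "\<beta> * \<eta> * \<sigma> = 1 / (1024 * X)" by simp
  then have \<tau>X: "\<tau> = 1 / (2 ^ 17 * X)" and \<epsilon>X: "\<epsilon> = 1 / (2 ^ 19 * X)"
    by (auto simp: \<tau>_def \<epsilon>_def)
  have ceil: "x \<le> real (nat \<lceil>x\<rceil>)" "real (nat \<lceil>x\<rceil>) \<le> 2 * x" if "1 \<le> x" for x :: real
    using that by linarith+
  define T where "T = nat \<lceil>2 ^ 17 * X\<rceil>"
  have T: "2 ^ 17 * X \<le> T" "T \<le> 2 ^ 18 * X"
    using X1 ceil[of "2 ^ 17 * X"] unfolding T_def by auto
  then have T1: "T \<ge> 1" using X1 by (cases T) auto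
  \<comment> \<open>Large enough for \<open>K * \<epsilon> / 2 \<ge> 4 * L\<close>, so that
    \<open>(1 + \<epsilon>) ^ K\<close> is at least \<open>exp (4 * L)\<close> and hence at least
    \<open>5 * N\<close>.\<close>
  define K where "K = nat \<lceil>2 ^ 22 * X * L\<rceil>"
  have XL: "1 \<le> X * L" using X1 L100 mult_mono[of 1 X 1 L] by simp
  then have K: "2 ^ 22 * (X * L) \<le> K" "K \<le> 2 ^ 23 * (X * L)"
    using ceil[of "2 ^ 22 * (X * L)"] unfolding K_def mult.assoc by auto
  have "2 ^ 23 * X \<le> L" using LX' X2 X1 by simp
  then have "2 ^ 23 * X * L \<le> L * L" using L100 by (intro mult_right_mono) auto
  then have KL: "K \<le> L\<^sup>2" using K(2) by (simp add: power2_eq_square)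
  have K1: "K \<ge> 1" using K(1) XL by (cases K) (auto simp: mult.commute)
  \<comment> \<open>\<open>1 / m\<close> is the final radius. From \<open>K \<le> L\<^sup>2\<close>
    follows \<open>m \<le> L ^ (10 * T)\<close>, and the pigeonhole bound with up to
    \<open>T\<close> frequencies loses at most \<open>m ^ (T + 1)\<close>, hence an exponent
    quadratic in \<open>T\<close>.\<close>
  define m where "m = 4 * K * (32 * K ^ 3) ^ T"
  have m1: "m > 0" using K1 by (simp add: m_def)
  have L32: "32 \<le> L" using L100 by simp
  have "4 * real K \<le> L * L\<^sup>2" using KL L32 by (intro mult_mono) auto
  then have m_a: "4 * real K \<le> L ^ 3" by (simp add: power2_eq_square power3_eq_cube)
  have "32 * real K ^ 3 \<le> L * (L\<^sup>2) ^ 3" using KL L32 by (intro mult_mono power_mono) auto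
  then have m_b: "32 * real K ^ 3 \<le> L ^ 7" by (simp add: power_mult [symmetric] flip: power_Suc)
  have "real m = 4 * real K * (32 * real K ^ 3) ^ T" by (simp add: m_def)
  also have "\<dots> \<le> L ^ 3 * (L ^ 7) ^ T"
    using m_a m_b L32 by (intro mult_mono power_mono) auto
  also have "\<dots> = L ^ (3 + 7 * T)" by (simp add: power_add power_mult)
  also have "\<dots> \<le> L ^ (10 * T)" using L32 T1 by (intro power_increasing) auto
  finally have "real m ^ (T + 1) \<le> (L ^ (10 * T)) ^ (T + 1)" by (intro power_mono) auto
  also have "\<dots> = L ^ (10 * T * (T + 1))" by (simp only: power_mult)
  also have "\<dots> = exp (real (10 * T * (T + 1)) * ln L)"
    using L32 by (subst exp_of_nat_mult) simp
  also have "\<dots> \<le> exp (L / 2)"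
  proof -
    have "real (10 * T * (T + 1)) \<le> 20 * (real T)\<^sup>2"
      using T1 by (simp add: power2_eq_square algebra_simps)
    also have "\<dots> \<le> 20 * (2 ^ 18 * X)\<^sup>2" using T(2) by (intro mult_left_mono power_mono) auto
    also have "\<dots> \<le> 2 ^ 71 * X\<^sup>2" by (simp add: power_mult_distrib)
    finally have "real (10 * T * (T + 1)) * ln L \<le> 2 ^ 71 * X\<^sup>2 * ln L"
      using lnL by (intro mult_right_mono) auto
    then show ?thesis using LX by simp
  qed
  finally have mT: "real m ^ (T + 1) \<le> exp (L / 2)" .
  \<comment> \<open>Half of the exponent \<open>L\<close> was spent on \<open>m\<close>; the other
    half covers the density factor \<open>D ^ s\<close>.\<close>
  have "D ^ s \<le> X" unfolding X_def using D assms(1) by (intro power_increasing) auto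
  also have "\<dots> \<le> L / 2" using LX' X2 X1 by simp
  also have "\<dots> \<le> exp (L / 2)" using exp_ge_add_one_self[of "L / 2"] by linarith
  finally have "D ^ s * real m ^ (T + 1) \<le> exp (L / 2) * exp (L / 2)"
    using mT D by (intro mult_mono) auto
  also have "\<dots> = N" by (simp add: NL flip: exp_add)
  finally have Nm: "D ^ s * real m ^ (T + 1) \<le> N" .

  show ?thesis
  proof (rule configuration_of_density_iteration[where s = s and A = A and \<beta> = \<beta> and N = N and K = K and T = T,
        folded \<eta>_def, folded \<sigma>_def, folded \<tau>_def \<epsilon>_def])
    show "1 < \<beta> + T * \<tau>"
    proof -
      have "1 = 2 ^ 17 * X * \<tau>" using X1 by (simp add: \<tau>X)
      also have "\<dots> \<le> T * \<tau>" using T(1) X1 by (intro mult_right_mono) (auto simp: \<tau>X)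
      finally show ?thesis using \<beta>D(2) by linarith
    qed
    show "1 / \<epsilon> \<le> K"
    proof -
      have "2 ^ 19 * X * 1 \<le> 2 ^ 22 * X * L" using X1 L100 by (intro mult_mono) auto
      also have "\<dots> \<le> K" using K(1) by (simp only: mult.assoc)
      finally show ?thesis by (simp add: \<epsilon>X)
    qed
    have \<epsilon>: "0 < \<epsilon>" "\<epsilon> \<le> 1 / 2" using X1 by (auto simp: \<epsilon>X field_simps)
    have "4 * L = 2 ^ 22 * (X * L) * (\<epsilon> / 2)" using X1 by (simp add: \<epsilon>X)
    also have "\<dots> \<le> K * (\<epsilon> / 2)" using K(1) \<epsilon> by (intro mult_right_mono) auto
    also have "\<epsilon> / 2 \<le> ln (1 + \<epsilon>)"
    proof -
      have "\<epsilon> * \<epsilon> \<le> \<epsilon> * (1 / 2)" using \<epsilon> by (intro mult_left_mono) auto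
      moreover have "\<epsilon> - \<epsilon> * \<epsilon> \<le> ln (1 + \<epsilon>)"
        using ln_one_plus_pos_lower_bound[of \<epsilon>] \<epsilon> by (simp add: power2_eq_square)
      ultimately show ?thesis by linarith
    qed
    finally have "4 * L \<le> K * ln (1 + \<epsilon>)" by (simp add: mult_left_mono)
    then have "exp (4 * L) \<le> exp (K * ln (1 + \<epsilon>))" by simp
    also have "\<dots> = (1 + \<epsilon>) ^ K" using \<epsilon> by (subst exp_of_nat_mult) simp
    finally have "exp (4 * L) \<le> (1 + \<epsilon>) ^ K" .
    moreover have "5 \<le> exp (3 * L)" using exp_ge_add_one_self[of "3 * L"] L100 by linarith
    then have "5 * real N \<le> exp (3 * L) * exp L"
      unfolding NL by (intro mult_right_mono) auto
    ultimately show "(1 + \<epsilon>) ^ K \<ge> 5 * N" by (simp flip: exp_add)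
    show "5 * \<beta> * N \<le> card A" using assms(4) by (simp add: \<beta>_def)
    fix \<Gamma> :: "real set" assume \<Gamma>: "finite \<Gamma>" "card \<Gamma> \<le> T"
    have "1 \<le> N / (D ^ s * real m ^ (T + 1))" using Nm D m1 by (subst le_divide_eq_1_pos) auto
    also have "\<dots> = (\<beta> / 4) ^ s * (N / real m ^ (T + 1))"
      by (simp add: \<beta>D(1) power_one_over)
    also have "\<dots> \<le> (\<beta> / 4) ^ s * (N / real m ^ (card \<Gamma> + 1))"
      using \<Gamma>(2) m1 \<beta>D(2) by (intro mult_left_mono divide_left_mono power_increasing mult_pos_pos) auto
    also have "\<dots> \<le> (\<beta> / 4) ^ s * card (bohr N \<Gamma> (1 / m))"
      using card_bohr_ge[OF \<Gamma>(1) m1] \<beta>D(2) by (intro mult_left_mono) auto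
    finally show "1 \<le> (\<beta> / 4) ^ s * card (bohr N \<Gamma> (1 / real (4 * K * (32 * K ^ 3) ^ T)))"
      by (simp only: m_def)
  qed (use assms \<beta>D in auto)
qed

end
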